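(* Let $G$ be a mixed order soluble group with finite rank. Then $\omega(G) = 3$ if and only if $G = A \rtimes H$ for some subgroups $A, H$ of $G$ such that $|H| = p$ for some prime $p$, $H$ acts fixed-point-freely on $A$ (by conjugation), and $A \cong \mathbb{Q}^n$ for some positive integer $n$, where $\mathbb{Q}^n$ is the direct sum of $n$ copies of the additive group of rational numbers.
   Context: For a group $G$, $\omega(G)$ denotes the number of orbits of the natural action of the automorphism group $\mathrm{Aut}(G)$ on $G$. A group $G$ has finite rank $r$ (for a positive integer $r$) if each finitely generated subgroup of $G$ can be generated by $r$ or fewer elements and $r$ is the least such integer. A group has mixed order if it contains non-trivial elements of finite order and also elements of infinite order. Writing $G = A \rtimes H$ for subgroups $A, H$ of $G$ means that $A$ is normal in $G$, $A \cap H = 1$ and $G = AH$. The action of $H$ on $A$ is fixed-point-free if no non-trivial element of $H$ fixes (i.e. commutes with) a non-trivial element of $A$. *)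

theory Defs
  imports "HOL-Algebra.Algebra"
begin

text \<open>The automorphism group acts on the carrier by application. As \<^const>\<open>card\<close> of an infinite
  set is \<open>0\<close>, the value \<open>0\<close> means that there are infinitely many orbits (a group always has at
  least one).\<close>

definition num_aut_orbits :: "('a, 'b) monoid_scheme \<Rightarrow> nat" where
  "num_aut_orbits G = card (orbits (AutoGroup G) (carrier G) (\<lambda>f. f))"

definition gen_by_at_most :: "('a, 'b) monoid_scheme \<Rightarrow> 'a set \<Rightarrow> nat \<Rightarrow> bool" where
  "gen_by_at_most G K r \<longleftrightarrow>
     (\<exists>T. T \<subseteq> carrier G \<and> finite T \<and> card T \<le> r \<and> generate G T = K)"

definition fg_subgroup :: "('a, 'b) monoid_scheme \<Rightarrow> 'a set \<Rightarrow> bool" where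
  "fg_subgroup G K \<longleftrightarrow> (\<exists>S. S \<subseteq> carrier G \<and> finite S \<and> generate G S = K)"

text \<open>The rank is by convention a positive integer, so the trivial group has rank \<open>1\<close>.\<close>

definition has_rank :: "('a, 'b) monoid_scheme \<Rightarrow> nat \<Rightarrow> bool" where
  "has_rank G r \<longleftrightarrow>
     0 < r \<and> (\<forall>K. fg_subgroup G K \<longrightarrow> gen_by_at_most G K r) \<and>
     (\<forall>s. 0 < s \<and> (\<forall>K. fg_subgroup G K \<longrightarrow> gen_by_at_most G K s) \<longrightarrow> r \<le> s)"

definition finite_rank :: "('a, 'b) monoid_scheme \<Rightarrow> bool" where
  "finite_rank G \<longleftrightarrow> (\<exists>r. has_rank G r)"

text \<open>\<^const>\<open>group.ord\<close> is \<open>0\<close> exactly on the elements of infinite order.\<close>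

definition mixed_order :: "('a, 'b) monoid_scheme \<Rightarrow> bool" where
  "mixed_order G \<longleftrightarrow>
     (\<exists>x\<in>carrier G. x \<noteq> \<one>\<^bsub>G\<^esub> \<and> group.ord G x \<noteq> 0) \<and>
     (\<exists>y\<in>carrier G. group.ord G y = 0)"

definition internal_semidirect :: "('a, 'b) monoid_scheme \<Rightarrow> 'a set \<Rightarrow> 'a set \<Rightarrow> bool" where
  "internal_semidirect G A H \<longleftrightarrow>
     A \<lhd> G \<and> subgroup H G \<and> A \<inter> H = {\<one>\<^bsub>G\<^esub>} \<and> A <#>\<^bsub>G\<^esub> H = carrier G"

definition fixed_point_free_conj :: "('a, 'b) monoid_scheme \<Rightarrow> 'a set \<Rightarrow> 'a set \<Rightarrow> bool" where
  "fixed_point_free_conj G H A \<longleftrightarrow>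
     (\<forall>h\<in>H - {\<one>\<^bsub>G\<^esub>}. \<forall>a\<in>A - {\<one>\<^bsub>G\<^esub>}. h \<otimes>\<^bsub>G\<^esub> a \<otimes>\<^bsub>G\<^esub> inv\<^bsub>G\<^esub> h \<noteq> a)"

definition rational_group :: "rat monoid" where
  "rational_group = \<lparr>carrier = UNIV, monoid.mult = (+), one = 0\<rparr>"

lemma group_rational_group: "group rational_group"
proof (rule groupI)
  fix x :: rat
  show "\<exists>y\<in>carrier rational_group. y \<otimes>\<^bsub>rational_group\<^esub> x = \<one>\<^bsub>rational_group\<^esub>"
    by (rule bexI[of _ "- x"]) (simp_all add: rational_group_def)
qed (simp_all add: rational_group_def)

definition rational_power_group :: "nat \<Rightarrow> (nat \<Rightarrow> rat) monoid" where
  "rational_power_group n = sum_group {..<n} (\<lambda>_. rational_group)"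

end

theory Submission
  imports Defs "HOL-Computational_Algebra.Polynomial_Factorial" "HOL-Library.Function_Algebras"
begin

text \<open>
  Suppose that \<open>\<omega>(G) = 3\<close>: the orbits are \<open>1\<close>, the non-trivial elements of finite order (all of one
  prime order \<open>p\<close>) and the elements of infinite order, which therefore have \<open>k\<close>-th roots of infinite
  order for all \<open>k\<close>. By solubility \<open>G'\<close> is a proper characteristic subgroup, and \<open>G'' = 1\<close>. If \<open>G'\<close> consisted
  of the elements of finite order it would be finite by the rank condition, hence centralised by all
  \<open>|G'|!\<close>-th powers and so central; then \<open>[x, z\<^sup>p] = [x, z]\<^sup>p = 1\<close> makes \<open>G\<close> abelian, which is impossible.
  So \<open>A = G'\<close> consists of \<open>1\<close> and the elements of infinite order; it is torsion-free divisible abelian of finite rank,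
  and the elements outside \<open>A\<close> act on it without fixed points. A norm computation excludes a subgroup
  of order \<open>p\<^sup>2\<close> of \<open>G / A\<close>.

  Conversely, for \<open>x, y\<close> outside \<open>A\<close> and non-trivial \<open>v, w \<in> A\<close> an automorphism with \<open>x \<mapsto> y\<close> and \<open>v \<mapsto> w\<close>
  is obtained from a linear automorphism of \<open>A\<close> that intertwines conjugation by \<open>x\<close> with conjugation
  by \<open>y\<close>. Both operators are annihilated by the irreducible polynomial \<open>1 + X + \<dots> + X\<^sup>p\<^sup>-\<^sup>1\<close>, so such a
  map can be extended from one cyclic submodule to the next.
\<close>

section \<open>Cyclotomic polynomials of prime index\<close>

text \<open>Since \<open>cyclotomic_prime p\<close> annihilates it, conjugation by an element
  outside \<open>A\<close> makes \<open>A\<close> a vector space over the p-th cyclotomic field. The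
  wanted linear map is an isomorphism between two such spaces of equal finite dimension that sends
  one given nonzero vector to another. The field itself is never built: integer polynomials act on a
  rational vector space, and a Bezout identity with a nonzero integer on the right replaces
  inversion in the field.

  Both this map and the automorphism of the group made from it are constructed as graphs, because
  their arguments are given by expressions that are not unique: \<open>N\<close> and
  \<open>q\<close> in the extension step, the exponent k in a x^k. For a graph compatible with the
  operations only the pairs with a neutral component have to be examined.

  In the forward direction, orbits and solubility show that \<open>A\<close> and G / A are abelian
  and that G / A has exponent p. That G / A is also cyclic does not follow from this alone; it is
  here that the fixed-point-free action is used.\<close>

lemma eisenstein_int:
  fixes f g :: "int poly" and p :: int
  assumes p: "Factorial_Ring.prime p" and lc: "\<not> p dvd lead_coeff (f * g)"
    and lower: "\<And>i. i < degree (f * g) \<Longrightarrow> p dvd coeff (f * g) i"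
    and c0: "\<not> p\<^sup>2 dvd coeff (f * g) 0"
  shows "degree f = 0 \<or> degree g = 0"
proof (rule ccontr)
  assume "\<not> ?thesis"
  hence df: "degree f > 0" and dg: "degree g > 0" by auto
  have nz: "f \<noteq> 0" "g \<noteq> 0" using df dg by auto
  have deg: "degree (f * g) = degree f + degree g" using nz by (simp add: degree_mult_eq)
  \<comment> \<open>Exactly one factor has a constant coefficient divisible by p; call it
    \<open>a\<close>. At the first index i where p does not divide \<open>coeff a i\<close>, the
    coefficient of the product is congruent to \<open>coeff a i * coeff b 0\<close> modulo p,
    although i lies below the top degree.\<close>
  have aux: False
    if ab: "p dvd coeff a 0" "\<not> p dvd coeff b 0" and fg: "f * g = a * b"
      and d: "degree a < degree (f * g)" for a b
  proof -
    have "\<not> p dvd lead_coeff a" using lc fg by (auto simp: lead_coeff_mult)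
    then have ex: "\<exists>i. \<not> p dvd coeff a i" by auto
    define i where "i = (LEAST i. \<not> p dvd coeff a i)"
    have i: "\<not> p dvd coeff a i" unfolding i_def by (rule LeastI_ex[OF ex])
    have less: "p dvd coeff a j" if "j < i" for j using not_less_Least that unfolding i_def by blast
    have "i \<le> degree a" using i le_degree[of a i] by (cases "coeff a i = 0") auto
    with d have "p dvd coeff (a * b) i" using lower fg by simp
    moreover have "coeff (a * b) i = (\<Sum>j<i. coeff a j * coeff b (i - j)) + coeff a i * coeff b 0"
      by (simp add: coeff_mult flip: lessThan_Suc_atMost)
    moreover have "p dvd (\<Sum>j<i. coeff a j * coeff b (i - j))"
      by (rule dvd_sum) (auto intro: dvd_mult2 less)
    ultimately have "p dvd coeff a i * coeff b 0" by (simp add: dvd_add_right_iff)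
    with p i ab(2) show False by (auto simp: prime_dvd_mult_iff)
  qed
  have "p dvd coeff f 0 * coeff g 0" using lower[of 0] deg df by (simp add: coeff_mult)
  hence "p dvd coeff f 0 \<or> p dvd coeff g 0" using p by (simp add: prime_dvd_mult_iff)
  moreover have "\<not> (p dvd coeff f 0 \<and> p dvd coeff g 0)"
    using c0 by (auto simp: coeff_mult power2_eq_square intro: mult_dvd_mono)
  ultimately show False
    using aux[of f g] aux[of g f] deg df dg by (auto simp: mult.commute)
qed

definition cyclotomic_prime :: "nat \<Rightarrow> int poly" where
  "cyclotomic_prime p = (\<Sum>i<p. monom 1 i)"

lemma coeff_cyclotomic_prime: "coeff (cyclotomic_prime p) i = (if i < p then 1 else 0)"
  by (simp add: cyclotomic_prime_def coeff_sum coeff_monom if_distrib sum.delta' cong: if_cong)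

lemma degree_cyclotomic_prime: "degree (cyclotomic_prime p) = p - 1"
proof (cases p)
  case (Suc n)
  show ?thesis
    by (rule antisym[OF degree_le le_degree]) (auto simp: coeff_cyclotomic_prime Suc)
qed (simp add: cyclotomic_prime_def)

text \<open>Substituting X + 1 for X in (X - 1)(1 + ... + X^(p-1)) = X^p - 1 shows that X times the
  shifted polynomial is (X + 1)^p - 1; coefficients are then compared one degree higher.\<close>

lemma coeff_cyclotomic_prime_shift:
  "coeff (pcompose (cyclotomic_prime p) [:1, 1:]) i = int (p choose Suc i)"
proof -
  have "[:-1, 1:] * cyclotomic_prime p = monom 1 p - 1"
  proof -
    have "monom 1 i = [:0, 1::int:] ^ i" for i
      by (simp add: monom_altdef)
    moreover have "[:-1, 1::int:] = [:0, 1:] - 1" by (simp add: one_pCons)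
    ultimately show ?thesis
      unfolding cyclotomic_prime_def by (metis (no_types, lifting) power_diff_1_eq sum.cong)
  qed
  then have "pcompose ([:-1, 1:] * cyclotomic_prime p) [:1, 1:] = pcompose (monom 1 p - 1) [:1, 1:]"
    by simp
  moreover have "pcompose (monom 1 p) [:1, 1:] = [:1, 1::int:] ^ p"
    unfolding monom_altdef by (induction p) (auto simp: pcompose_mult pcompose_pCons pcompose_1)
  ultimately have "[:0, 1:] * pcompose (cyclotomic_prime p) [:1, 1:] = [:1, 1:] ^ p - 1"
    by (simp add: pcompose_mult pcompose_diff pcompose_pCons pcompose_1)
  then have "coeff ([:0, 1:] * pcompose (cyclotomic_prime p) [:1, 1:]) (Suc i)
      = coeff ([:1, 1::int:] ^ p - 1) (Suc i)" by simp
  then show ?thesis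
    by (cases "Suc i \<le> p") (simp_all add: coeff_linear_poly_power coeff_eq_0 degree_linear_power)
qed

text \<open>Eisenstein applies after the shift by 1: the constant coefficient becomes p, the leading
  one is 1, and all below the top are binomials divisible by p.\<close>

lemma irreducible_cyclotomic_prime:
  assumes p: "Factorial_Ring.prime p"
  shows "Factorial_Ring.irreducible (cyclotomic_prime p)"
proof (rule Factorial_Ring.irreducibleI)
  have p1: "p > 1" using p by (rule prime_gt_1_nat)
  let ?c = "cyclotomic_prime p"
  show "?c \<noteq> 0" using coeff_cyclotomic_prime[of p 0] p1 by auto
  show "\<not> is_unit ?c" using degree_cyclotomic_prime[of p] p1 by (auto simp: is_unit_poly_iff)
  fix f g assume fg: "?c = f * g"
  \<comment> \<open>Over the integers a constant factor need not be a unit; here it divides the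
    constant coefficient 1.\<close>
  have unit: "is_unit a" if ab: "?c = a * b" and da: "degree a = 0" for a b
  proof -
    obtain k where k: "a = [:k:]" using da degree_eq_zeroE by blast
    have "coeff ?c 0 = k * coeff b 0" using ab k by (simp add: coeff_mult)
    then have "k * coeff b 0 = 1" using p1 by (simp add: coeff_cyclotomic_prime)
    then have "is_unit k" by (metis dvd_triv_left)
    then show ?thesis using k by (auto simp: is_unit_poly_iff)
  qed
  define F G :: "int poly" where "F = pcompose f [:1, 1:]" and "G = pcompose g [:1, 1:]"
  have FG: "F * G = pcompose ?c [:1, 1:]" by (simp add: F_def G_def fg pcompose_mult)
  have deg: "degree (F * G) = p - 1" by (simp add: FG degree_pcompose degree_cyclotomic_prime)
  have "degree F = 0 \<or> degree G = 0"
  proof (rule eisenstein_int)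
    show "Factorial_Ring.prime (int p)" using p by simp
    show "\<not> int p dvd lead_coeff (F * G)"
      unfolding deg unfolding FG coeff_cyclotomic_prime_shift using p1 by simp
    show "\<not> (int p)\<^sup>2 dvd coeff (F * G) 0"
      unfolding FG coeff_cyclotomic_prime_shift using p1
      by (auto simp: power2_eq_square)
    show "int p dvd coeff (F * G) i" if "i < degree (F * G)" for i
      unfolding FG coeff_cyclotomic_prime_shift using that deg p dvd_choose_prime[of "Suc i" p] p1 by simp
  qed
  then have "degree f = 0 \<or> degree g = 0" by (simp add: F_def G_def degree_pcompose)
  then show "is_unit f \<or> is_unit g"
    using unit[of f g] unit[of g f] fg by (auto simp: mult.commute)
qed

text \<open>The Bezout identity over the rationals with denominators cleared. A nonzero combination
  r of least degree divides nonzero integer multiples of q and of P. As P does not divide r, it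
  divides the cofactor s in a P = r s, and cancelling P leaves r as a divisor of the integer
  a.\<close>

lemma prime_elem_poly_int_bezout:
  fixes P q :: "int poly"
  assumes P: "prime_elem P" "degree P > 0" and q: "\<not> P dvd q"
  obtains u v N where "N \<noteq> 0" "u * q + v * P = [:N:]"
proof -
  define I where "I = {u * q + v * P |u v. u * q + v * P \<noteq> 0}"
  have "0 * q + 1 * P \<in> I" unfolding I_def using P by (intro CollectI exI[of _ 0] exI[of _ 1]) auto
  then obtain r where r: "r \<in> I" and min: "\<And>s. s \<in> I \<Longrightarrow> degree r \<le> degree s"
    using arg_min_nat_lemma[of "\<lambda>r. r \<in> I"  _ degree] by blast
  obtain u v where uv: "r = u * q + v * P" and r0: "r \<noteq> 0" using r unfolding I_def by blast
  have divides: "\<exists>a s. a \<noteq> 0 \<and> smult a f = r * s" if f: "f = u' * q + v' * P" for f u' v'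
  proof -
    obtain a s where a: "a \<noteq> 0" "smult a f = r * s + pseudo_mod f r" 
      and d: "pseudo_mod f r = 0 \<or> degree (pseudo_mod f r) < degree r"
      using pseudo_mod[OF r0, of f] by blast
    \<comment> \<open>The pseudo-remainder is again a combination of q and P, so minimality of the
      degree of r forces it to vanish.\<close>
    have "pseudo_mod f r = (smult a u' - s * u) * q + (smult a v' - s * v) * P"
      using a(2) unfolding f uv by (simp add: algebra_simps smult_add_right)
    then have "\<exists>u v. pseudo_mod f r = u * q + v * P" by blast
    then have "pseudo_mod f r \<in> I \<or> pseudo_mod f r = 0" unfolding I_def by fastforce
    then have "pseudo_mod f r = 0" using d min by fastforce
    then show ?thesis using a by auto
  qed
  have const: "\<not> P dvd [:a:]" if "a \<noteq> 0" for a
    using that P(2) dvd_imp_degree_le[of P "[:a:]"] by auto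
  have Pr: "\<not> P dvd r"
  proof
    assume Pr: "P dvd r"
    obtain a s where a: "a \<noteq> 0" "smult a q = r * s" using divides[of q 1 0] by auto
    have "P dvd [:a:] * q" using a Pr by simp
    then show False using P(1) q const[OF a(1)] prime_elem_dvd_mult_iff by blast
  qed
  obtain a s where a: "a \<noteq> 0" "smult a P = r * s" using divides[of P 0 1] by auto
  have "P dvd r * s" unfolding a(2)[symmetric] by (simp add: dvd_smult)
  then have "P dvd s" using Pr P(1) by (simp add: prime_elem_dvd_mult_iff)
  then obtain t where "s = P * t" by auto
  then have "P * [:a:] = P * (r * t)" using a(2) by (simp add: algebra_simps)
  then have "[:a:] = r * t" using P(1) by (metis mult_cancel_left prime_elem_not_zeroI)
  then have "r dvd [:a:]" by (metis dvd_triv_left)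
  then have "degree r = 0" using a(1) dvd_imp_degree_le[of r "[:a:]"] by auto
  then obtain N where "r = [:N:]" using degree_eq_zeroE by blast
  then show ?thesis using that[of N u v] uv r0 by auto
qed

section \<open>Rational operators with an irreducible annihilator\<close>

text \<open>The value of q(T) at x. The coefficients are integers because primality of the
  annihilator is established in \<open>int poly\<close>; rational scalars act separately through
  s.\<close>

definition poly_act :: "(rat \<Rightarrow> 'v \<Rightarrow> 'v) \<Rightarrow> ('v \<Rightarrow> 'v) \<Rightarrow> int poly \<Rightarrow> 'v \<Rightarrow> 'v::ab_group_add" where
  "poly_act s T q x = (\<Sum>i\<le>degree q. s (of_int (coeff q i)) ((T ^^ i) x))"

text \<open>Only additivity is assumed, as that is what conjugation provides; linearity over the
  rationals is derived in \<open>T_scale\<close>.\<close>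

locale rat_operator = vector_space scale
  for scale :: "rat \<Rightarrow> 'v::ab_group_add \<Rightarrow> 'v" (infixr "*s" 75) +
  fixes V :: "'v set" and T :: "'v \<Rightarrow> 'v"
  assumes V: "subspace V"
    and T_closed: "x \<in> V \<Longrightarrow> T x \<in> V"
    and T_add: "\<lbrakk>x \<in> V; y \<in> V\<rbrakk> \<Longrightarrow> T (x + y) = T x + T y"
begin

abbreviation act :: "int poly \<Rightarrow> 'v \<Rightarrow> 'v" where
  "act \<equiv> poly_act scale T"

lemma T_0: "T 0 = 0"
  using T_add[of 0 0] V by (simp add: subspace_0)

lemma T_scale_of_nat: "x \<in> V \<Longrightarrow> T (of_nat n *s x) = of_nat n *s T x"
proof (induction n)
  case (Suc n)
  then show ?case using V by (simp add: scale_left_distrib T_add subspace_scale)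
qed (simp add: T_0)

text \<open>An additive map respects integer multiples, and a denominator can be cancelled after
  multiplying by it.\<close>

lemma T_scale:
  assumes x: "x \<in> V"
  shows "T (c *s x) = c *s T x"
proof -
  have neg: "T (- y) = - T y" if "y \<in> V" for y
    using T_add[of y "- y"] that V by (simp add: subspace_neg T_0 eq_neg_iff_add_eq_0 add.commute)
  have int: "T (of_int k *s y) = of_int k *s T y" if "y \<in> V" for k y
  proof (cases k)
    case (neg n)
    show ?thesis unfolding neg using that V
      by (simp add: \<open>\<And>y. y \<in> V \<Longrightarrow> T (- y) = - T y\<close> T_scale_of_nat subspace_scale
          flip: of_nat_Suc)
  qed (use that T_scale_of_nat in simp)
  obtain a b where c: "c = of_int a / of_int b" "b > 0"
    by (metis quotient_of_div quotient_of_denom_pos prod.exhaust)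
  have "of_int b *s T (c *s x) = T (of_int b *s c *s x)"
    using x V by (simp only: int subspace_scale)
  also have "\<dots> = T (of_int a *s x)" using c by simp
  also have "\<dots> = of_int b *s c *s T x" using c by (simp add: int x)
  finally show ?thesis using c(2) by (simp del: scale_scale)
qed

lemma funpow_closed: "x \<in> V \<Longrightarrow> (T ^^ i) x \<in> V"
  by (induction i) (auto intro: T_closed)

lemma act_eq_sum:
  assumes "degree q \<le> n"
  shows "act q x = (\<Sum>i\<le>n. of_int (coeff q i) *s (T ^^ i) x)"
  unfolding poly_act_def
  by (rule sum.mono_neutral_left) (use assms in \<open>auto simp: coeff_eq_0\<close>)

lemma act_closed: "x \<in> V \<Longrightarrow> act q x \<in> V"
  unfolding poly_act_def using V by (intro subspace_sum subspace_scale funpow_closed)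

lemma act_0 [simp]: "act 0 x = 0"
  by (simp add: poly_act_def)

lemma act_add: "act (q + r) x = act q x + act r x"
proof -
  let ?n = "max (degree q) (degree r)"
  show ?thesis
    using act_eq_sum[of q ?n x] act_eq_sum[of r ?n x] act_eq_sum[of "q + r" ?n x]
    by (simp add: degree_add_le scale_left_distrib sum.distrib)
qed

lemma act_smult: "act (smult k q) x = of_int k *s act q x"
  using act_eq_sum[of "smult k q" "degree q" x]
  by (simp add: degree_smult_le poly_act_def scale_sum_right)

lemma act_const: "act [:k:] x = of_int k *s x"
  by (simp add: poly_act_def)

lemma act_0_right [simp]: "act q 0 = 0"
proof -
  have "(T ^^ i) 0 = 0" for i by (induction i) (simp_all add: T_0)
  then show ?thesis by (simp add: poly_act_def)
qed

lemma act_pCons: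
  assumes "x \<in> V"
  shows "act (pCons k q) x = of_int k *s x + act q (T x)"
proof -
  have "act (pCons k q) x = (\<Sum>i\<le>Suc (degree q). of_int (coeff (pCons k q) i) *s (T ^^ i) x)"
    by (rule act_eq_sum) (rule degree_pCons_le)
  also have "\<dots> = of_int k *s x + (\<Sum>i\<le>degree q. of_int (coeff q i) *s (T ^^ i) (T x))"
    unfolding sum.atMost_Suc_shift by (simp add: funpow_swap1)
  finally show ?thesis by (simp add: poly_act_def)
qed

lemma act_T: "x \<in> V \<Longrightarrow> act q (T x) = T (act q x)"
proof (induction q arbitrary: x)
  case (pCons a q)
  then show ?case
    using V by (simp add: act_pCons T_closed T_add T_scale act_closed subspace_scale)
qed (simp add: T_0)

lemma act_mult: "x \<in> V \<Longrightarrow> act (q * r) x = act q (act r x)"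
proof (induction q arbitrary: x)
  case (pCons a q)
  then show ?case
    by (simp add: mult_pCons_left act_add act_smult act_pCons act_closed act_T T_closed)
qed simp

text \<open>T permutes the summands x, T x, ..., T^(p-1) x cyclically, so their sum is a fixed point
  and hence 0.\<close>

lemma act_cyclotomic_prime:
  assumes period: "\<And>x. x \<in> V \<Longrightarrow> (T ^^ p) x = x" and free: "\<And>x. \<lbrakk>x \<in> V; T x = x\<rbrakk> \<Longrightarrow> x = 0"
    and p: "p > 0" and x: "x \<in> V"
  shows "act (cyclotomic_prime p) x = 0"
proof -
  obtain m where m: "p = Suc m" using p by (cases p) auto
  have act: "act (cyclotomic_prime p) x = (\<Sum>i<p. (T ^^ i) x)"
    unfolding poly_act_def degree_cyclotomic_prime coeff_cyclotomic_prime
    using m by (simp add: lessThan_Suc_atMost)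
  have "T (act (cyclotomic_prime p) x) = act (cyclotomic_prime p) (T x)"
    using act_T x by simp
  also have "\<dots> = (\<Sum>i<p. (T ^^ i) (T x))"
    unfolding poly_act_def degree_cyclotomic_prime coeff_cyclotomic_prime
    using m by (simp add: lessThan_Suc_atMost)
  also have "\<dots> = (\<Sum>i<p. (T ^^ Suc i) x)" by (simp add: funpow_swap1)
  also have "\<dots> = (\<Sum>i<p. (T ^^ i) x)"
    unfolding m sum.lessThan_Suc_shift[of "\<lambda>i. (T ^^ i) x"] sum.lessThan_Suc[of "\<lambda>i. (T ^^ Suc i) x"]
    using period[OF x] m by (simp add: add.commute)
  finally have "T (\<Sum>i<p. (T ^^ i) x) = (\<Sum>i<p. (T ^^ i) x)" unfolding act .
  moreover have "(\<Sum>i<p. (T ^^ i) x) \<in> V" unfolding act[symmetric] by (rule act_closed[OF x])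
  ultimately show ?thesis using free act by simp
qed

end

text \<open>Partial isomorphisms are represented by their graphs, so that well-definedness and injectivity
  become the same condition for \<open>\<Gamma>\<close> and its converse.\<close>

locale intertwining_graph =
  dom: rat_operator scale V T + ran: rat_operator scale V T'
  for scale :: "rat \<Rightarrow> 'v::ab_group_add \<Rightarrow> 'v" (infixr "*s" 75) and V T T' +
  fixes \<Gamma> :: "('v \<times> 'v) set"
  assumes sub: "\<Gamma> \<subseteq> V \<times> V"
    and zero: "(0, 0) \<in> \<Gamma>"
    and add: "\<lbrakk>(a, b) \<in> \<Gamma>; (c, d) \<in> \<Gamma>\<rbrakk> \<Longrightarrow> (a + c, b + d) \<in> \<Gamma>"
    and scale: "(a, b) \<in> \<Gamma> \<Longrightarrow> (k *s a, k *s b) \<in> \<Gamma>"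
    and TT': "(a, b) \<in> \<Gamma> \<Longrightarrow> (T a, T' b) \<in> \<Gamma>"
    and fst0: "(0, b) \<in> \<Gamma> \<Longrightarrow> b = 0"
    and snd0: "(a, 0) \<in> \<Gamma> \<Longrightarrow> a = 0"
begin

lemma act_graph: "(a, b) \<in> \<Gamma> \<Longrightarrow> (dom.act q a, ran.act q b) \<in> \<Gamma>"
proof (induction q arbitrary: a b)
  case (pCons k q)
  moreover have "a \<in> V" "b \<in> V" using pCons.prems sub by auto
  ultimately show ?case
    by (simp add: dom.act_pCons ran.act_pCons add scale TT')
qed (simp add: zero)

end

lemma (in intertwining_graph) converse_graph: "intertwining_graph scale V T' T (\<Gamma>\<inverse>)"
proof unfold_locales
  show "\<Gamma>\<inverse> \<subseteq> V \<times> V" using sub by auto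
qed (auto intro: zero add scale TT' fst0 snd0)

locale annihilated_graph = intertwining_graph scale V T T' \<Gamma>
  for scale :: "rat \<Rightarrow> 'v::ab_group_add \<Rightarrow> 'v" (infixr "*s" 75) and V T T' \<Gamma> +
  fixes P :: "int poly"
  assumes P: "prime_elem P" "degree P > 0"
    and ann: "x \<in> V \<Longrightarrow> poly_act scale T P x = 0" "x \<in> V \<Longrightarrow> poly_act scale T' P x = 0"
begin

lemma converse_ann: "annihilated_graph scale V T' T (\<Gamma>\<inverse>) P"
  using converse_graph P ann
  by (simp add: annihilated_graph_def annihilated_graph_axioms_def)

text \<open>The cyclic submodule of x meets the domain only in 0: otherwise u q + v P = N gives N x
  = u(T)(q(T) x), which lies in the invariant domain, and dividing by N puts x there as
  well.\<close>

lemma act_eq_0_if_mem_Domain: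
  assumes x: "x \<in> V" "x \<notin> Domain \<Gamma>" and q: "dom.act q x \<in> Domain \<Gamma>"
  shows "P dvd q"
proof (rule ccontr)
  assume "\<not> P dvd q"
  then obtain u v N where N: "N \<noteq> 0" "u * q + v * P = [:N:]"
    using prime_elem_poly_int_bezout P by blast
  have "of_int N *s x = dom.act (u * q + v * P) x"
    unfolding N(2) dom.act_const ..
  also have "\<dots> = dom.act u (dom.act q x)"
    using x(1) by (simp add: dom.act_add dom.act_mult ann)
  finally have "of_int N *s x \<in> Domain \<Gamma>" using q act_graph by auto
  then obtain z where "(of_int N *s x, z) \<in> \<Gamma>" by auto
  from scale[OF this, of "1 / of_int N"] N(1) x(2) show False by auto
qed

text \<open>The factor \<open>N\<close> makes the extension closed under rational multiples although only integer polynomials act.\<close>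

definition extension :: "'v \<Rightarrow> 'v \<Rightarrow> ('v \<times> 'v) set" where
  "extension x y = {(a, b). a \<in> V \<and> b \<in> V \<and> (\<exists>N d e q. N \<noteq> 0 \<and> (d, e) \<in> \<Gamma> \<and>
     of_int N *s a = d + dom.act q x \<and> of_int N *s b = e + ran.act q y)}"

lemma extensionI:
  "\<lbrakk>a \<in> V; b \<in> V; N \<noteq> 0; (d, e) \<in> \<Gamma>; of_int N *s a = d + dom.act q x; of_int N *s b = e + ran.act q y\<rbrakk>
    \<Longrightarrow> (a, b) \<in> extension x y"
  unfolding extension_def by blast

text \<open>From d + q(T) x = 0 it follows that q(T) x lies in the domain, so P divides q. Then both
  polynomial terms vanish, and what remains is a pair of the old graph with first component
  0.\<close>

lemma extension_fst0:
  assumes x: "x \<in> V" "x \<notin> Domain \<Gamma>" and y: "y \<in> V" and b: "(0, b) \<in> extension x y"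
  shows "b = 0"
proof -
  obtain N d e q where *: "N \<noteq> 0" "(d, e) \<in> \<Gamma>" "0 = d + dom.act q x" "of_int N *s b = e + ran.act q y"
    using b unfolding extension_def by auto
  have "dom.act q x = - d" using *(3) by (simp add: add_eq_0_iff)
  then have "dom.act q x \<in> Domain \<Gamma>" using scale[OF *(2), of "-1"] by auto
  then obtain r where "q = r * P" using act_eq_0_if_mem_Domain[OF x] by (metis dvd_def mult.commute)
  then have "dom.act q x = 0" "ran.act q y = 0" using x y by (simp_all add: dom.act_mult ran.act_mult ann)
  then have "of_int N *s b = 0" using * fst0 by auto
  then show ?thesis using *(1) by simp
qed

text \<open>This turns injectivity of the extension into an instance of
  \<open>extension_fst0\<close> for the converse graph.\<close>

lemma extension_converse:
  "annihilated_graph.extension scale V T' T (\<Gamma>\<inverse>) y x = (extension x y)\<inverse>"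
  unfolding annihilated_graph.extension_def[OF converse_ann] extension_def by blast

lemma annihilated_extension:
  assumes x: "x \<in> V" "x \<notin> Domain \<Gamma>" and y: "y \<in> V" "y \<notin> Range \<Gamma>"
  shows "annihilated_graph scale V T T' (extension x y) P"
proof unfold_locales
  note V = dom.V
  show "extension x y \<subseteq> V \<times> V" by (auto simp: extension_def)
  show "(0, 0) \<in> extension x y"
    by (rule extensionI[where N = 1 and d = 0 and e = 0 and q = 0]) (use zero V dom.subspace_0 in auto)
  show "(a + c, b + d) \<in> extension x y" if ab: "(a, b) \<in> extension x y" and cd: "(c, d) \<in> extension x y" for a b c d
  proof -
    obtain N a' b' q where 1: "a \<in> V" "b \<in> V" "N \<noteq> 0" "(a', b') \<in> \<Gamma>"
      "of_int N *s a = a' + dom.act q x" "of_int N *s b = b' + ran.act q y"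
      using ab unfolding extension_def by auto
    obtain M c' d' r where 2: "c \<in> V" "d \<in> V" "M \<noteq> 0" "(c', d') \<in> \<Gamma>"
      "of_int M *s c = c' + dom.act r x" "of_int M *s d = d' + ran.act r y"
      using cd unfolding extension_def by auto
    \<comment> \<open>The product of the two denominators serves as common denominator for the
      sum.\<close>
    have *: "of_int (N * M) *s (u + v) = of_int M *s of_int N *s u + of_int N *s of_int M *s v" for u v :: 'v
      by (simp add: dom.scale_right_distrib mult.commute)
    show ?thesis
    proof (rule extensionI)
      show "N * M \<noteq> 0" using 1 2 by simp
      show "(of_int M *s a' + of_int N *s c', of_int M *s b' + of_int N *s d') \<in> \<Gamma>"
        using 1 2 by (intro add scale)
      show "of_int (N * M) *s (a + c) = of_int M *s a' + of_int N *s c' + dom.act (smult M q + smult N r) x"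
        unfolding * 1 2 by (simp add: dom.act_add dom.act_smult dom.scale_right_distrib)
      show "of_int (N * M) *s (b + d) = of_int M *s b' + of_int N *s d' + ran.act (smult M q + smult N r) y"
        unfolding * 1 2 by (simp add: ran.act_add ran.act_smult dom.scale_right_distrib)
    qed (use 1 2 V dom.subspace_add in auto)
  qed
  show "(k *s a, k *s b) \<in> extension x y" if ab: "(a, b) \<in> extension x y" for a b k
  proof -
    obtain N a' b' q where 1: "a \<in> V" "b \<in> V" "N \<noteq> 0" "(a', b') \<in> \<Gamma>"
      "of_int N *s a = a' + dom.act q x" "of_int N *s b = b' + ran.act q y"
      using ab unfolding extension_def by auto
    obtain m n where k: "k = of_int m / of_int n" "n > 0"
      by (metis quotient_of_div quotient_of_denom_pos prod.exhaust)
    have *: "of_int (N * n) *s k *s u = of_int m *s of_int N *s u" for u :: 'v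
      using k by (simp add: mult.commute)
    show ?thesis
    proof (rule extensionI)
      show "N * n \<noteq> 0" using 1 k by simp
      show "(of_int m *s a', of_int m *s b') \<in> \<Gamma>" using 1 by (intro scale)
      show "of_int (N * n) *s k *s a = of_int m *s a' + dom.act (smult m q) x"
        unfolding * 1 by (simp add: dom.act_smult dom.scale_right_distrib)
      show "of_int (N * n) *s k *s b = of_int m *s b' + ran.act (smult m q) y"
        unfolding * 1 by (simp add: ran.act_smult dom.scale_right_distrib)
    qed (use 1 V dom.subspace_scale in auto)
  qed
  show "(T a, T' b) \<in> extension x y" if ab: "(a, b) \<in> extension x y" for a b
  proof -
    obtain N a' b' q where 1: "a \<in> V" "b \<in> V" "N \<noteq> 0" "(a', b') \<in> \<Gamma>"
      "of_int N *s a = a' + dom.act q x" "of_int N *s b = b' + ran.act q y"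
      using ab unfolding extension_def by auto
    have V': "a' \<in> V" "b' \<in> V" using 1 sub by auto
    show ?thesis
    proof (rule extensionI)
      show "(T a', T' b') \<in> \<Gamma>" using 1 by (intro TT')
      have "of_int N *s T a = T (of_int N *s a)" using 1(1) by (simp only: dom.T_scale)
      \<comment> \<open>Applying T amounts to multiplying the polynomial by X, which is
        \<open>pCons 0\<close>.\<close>
      also have "\<dots> = T a' + dom.act (pCons 0 q) x"
        unfolding 1 using V' x by (simp add: dom.T_add dom.act_closed dom.act_pCons dom.act_T)
      finally show "of_int N *s T a = T a' + dom.act (pCons 0 q) x" .
      have "of_int N *s T' b = T' (of_int N *s b)" using 1(2) by (simp only: ran.T_scale)
      also have "\<dots> = T' b' + ran.act (pCons 0 q) y"
        unfolding 1 using V' y by (simp add: ran.T_add ran.act_closed ran.act_pCons ran.act_T)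
      finally show "of_int N *s T' b = T' b' + ran.act (pCons 0 q) y" .
    qed (use 1 dom.T_closed ran.T_closed in auto)
  qed
  show "b = 0" if "(0, b) \<in> extension x y" for b
    using extension_fst0[OF x y(1) that] .
  show "a = 0" if "(a, 0) \<in> extension x y" for a
    using annihilated_graph.extension_fst0[OF converse_ann, of y x a] that x y
    by (auto simp: extension_converse)
qed (use P ann in auto)

lemma extension_superset: "\<Gamma> \<subseteq> extension x y"
proof (rule subrelI)
  fix a b assume "(a, b) \<in> \<Gamma>"
  then show "(a, b) \<in> extension x y"
    using sub by (intro extensionI[where N = 1 and d = a and e = b and q = 0]) auto
qed

lemma extension_mem: "\<lbrakk>x \<in> V; y \<in> V\<rbrakk> \<Longrightarrow> (x, y) \<in> extension x y"
  by (rule extensionI[where N = 1 and d = 0 and e = 0 and q = 1])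
    (simp_all add: zero one_pCons dom.act_const ran.act_const)

end

section \<open>Dimension inside a finitely spanned set\<close>

context vector_space
begin

text \<open>Finiteness is required only of a span containing D, because the ambient space, later
  \<open>nat \<Rightarrow> rat\<close>, has infinite dimension.\<close>

lemma independent_card_le_dim_finite:
  assumes B: "finite B" "D \<subseteq> span B" and S: "S \<subseteq> D" "independent S"
  shows "finite S" "card S \<le> dim D"
proof -
  obtain C where C: "S \<subseteq> C" "C \<subseteq> D" "independent C" "D \<subseteq> span C"
    using maximal_independent_subset_extend[OF S] by blast
  have "finite C" using independent_span_bound[OF B(1) C(3)] C(2) B(2) by simp
  then show "finite S" "card S \<le> dim D"
    using C(1) basis_card_eq_dim[OF C(2,4,3)] card_mono[of C S] finite_subset[of S C] by simp_all
qed

lemma dim_strict_mono_finite: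
  assumes B: "finite B" "E \<subseteq> span B" and D: "subspace D" "D \<subset> E"
  shows "dim D < dim E"
proof -
  obtain C where C: "C \<subseteq> D" "independent C" "D \<subseteq> span C" "card C = dim D"
    using basis_exists by blast
  obtain x where x: "x \<in> E" "x \<notin> D" using D by blast
  have "span C \<subseteq> D" using C(1) D(1) by (rule span_minimal)
  then have "x \<notin> span C" "x \<notin> C" using x C by auto
  moreover have "finite C"
    using independent_card_le_dim_finite(1)[OF B _ C(2)] C(1) D(2) by simp
  ultimately have "card (insert x C) = Suc (dim D)" "independent (insert x C)"
    using C by (auto simp: independent_insert)
  moreover have "insert x C \<subseteq> E" using C x D by auto
  ultimately show ?thesis
    using independent_card_le_dim_finite(2)[OF B, of "insert x C"] by simp
qed

end

context intertwining_graph
begin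

lemma subspace_Domain: "dom.subspace (Domain \<Gamma>)"
proof (rule dom.subspaceI)
  show "0 \<in> Domain \<Gamma>" using zero by blast
  show "x + y \<in> Domain \<Gamma>" if "x \<in> Domain \<Gamma>" "y \<in> Domain \<Gamma>" for x y
    using that add by (elim DomainE) (rule DomainI)
  show "c *s x \<in> Domain \<Gamma>" if "x \<in> Domain \<Gamma>" for c x
    using that scale by (elim DomainE) (rule DomainI)
qed

lemma sum_graph: "(\<And>i. i \<in> I \<Longrightarrow> (f i, g i) \<in> \<Gamma>) \<Longrightarrow> (sum f I, sum g I) \<in> \<Gamma>"
  by (induction I rule: infinite_finite_induct) (auto intro: zero add)

lemma graph_fun: "\<lbrakk>(a, b) \<in> \<Gamma>; (a, c) \<in> \<Gamma>\<rbrakk> \<Longrightarrow> b = c"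
  using add[of a b "- a" "- c"] scale[of a c "-1"] fst0[of "b - c"] by simp

text \<open>Preimages of a basis of the range are independent: a relation among them puts the pair
  of 0 and the same relation among the basis vectors into the graph, and \<open>fst0\<close>
  applies.\<close>

lemma dim_Range_le:
  assumes B: "finite B" "V \<subseteq> dom.span B"
  shows "dom.dim (Range \<Gamma>) \<le> dom.dim (Domain \<Gamma>)"
proof -
  obtain C where C: "C \<subseteq> Range \<Gamma>" "dom.independent C" "Range \<Gamma> \<subseteq> dom.span C" "card C = dom.dim (Range \<Gamma>)"
    using dom.basis_exists by blast
  have fin: "finite C" using dom.independent_card_le_dim_finite[OF B(1) _ C(1,2)] sub B by auto
  have "\<exists>g. \<forall>b\<in>C. (g b, b) \<in> \<Gamma>" using C by (intro bchoice) auto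
  then obtain g where g: "\<And>b. b \<in> C \<Longrightarrow> (g b, b) \<in> \<Gamma>" by blast
  have inj: "inj_on g C"
  proof (rule inj_onI)
    fix b c assume "b \<in> C" "c \<in> C" "g b = g c"
    then show "b = c" using graph_fun[of "g b" b c] g[of b] g[of c] by simp
  qed
  have "dom.independent (g ` C)"
  proof (rule dom.independent_if_scalars_zero)
    fix f x assume f: "(\<Sum>x\<in>g ` C. f x *s x) = 0" and x: "x \<in> g ` C"
    have "(\<Sum>b\<in>C. f (g b) *s g b) = 0" using f inj by (simp add: sum.reindex)
    then have "(0, \<Sum>b\<in>C. f (g b) *s b) \<in> \<Gamma>" using sum_graph[of C "\<lambda>b. f (g b) *s g b" "\<lambda>b. f (g b) *s b"] scale g by simp
    then have "(\<Sum>b\<in>C. f (g b) *s b) = 0" by (rule fst0)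
    from dom.independentD[OF C(2) fin subset_refl this] show "f x = 0" using x by auto
  qed (use fin in auto)
  moreover have "g ` C \<subseteq> Domain \<Gamma>" using g by auto
  ultimately have "card (g ` C) \<le> dom.dim (Domain \<Gamma>)"
    using dom.independent_card_le_dim_finite(2)[OF B(1), of "Domain \<Gamma>" "g ` C"] sub B by auto
  then show ?thesis using C inj by (simp add: card_image)
qed

text \<open>As long as a partial isomorphism is not total, this provides an element outside its
  domain and one outside its range at the same time, as \<open>annihilated_extension\<close>
  requires. It rests on domain and range having equal dimension.\<close>

lemma Domain_eq_iff_Range_eq:
  assumes B: "finite B" "V \<subseteq> dom.span B"
  shows "Domain \<Gamma> = V \<longleftrightarrow> Range \<Gamma> = V"
proof -
  have *: "Domain \<Delta> = V" if "intertwining_graph scale V S S' \<Delta>" "Range \<Delta> = V" for S S' \<Delta>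
  proof -
    interpret d: intertwining_graph scale V S S' \<Delta> by fact
    have "Domain \<Delta> \<subseteq> V" using d.sub by auto
    then show ?thesis
      using d.dim_Range_le[OF B] dom.dim_strict_mono_finite[OF B d.subspace_Domain] that(2)
      by (meson leD psubsetI)
  qed
  show ?thesis using *[OF intertwining_graph_axioms] *[OF converse_graph] by (simp; blast)
qed

end

text \<open>Among the graphs containing (v, w) one with domain of largest dimension is total, since
  otherwise it could be extended by one more pair. The existence of some such graph comes from
  extending the zero graph by (v, w).\<close>

theorem intertwiner_exists:
  fixes scale :: "rat \<Rightarrow> 'v::ab_group_add \<Rightarrow> 'v"
  assumes "rat_operator scale V T" "rat_operator scale V T'"
    and P: "prime_elem P" "degree P > 0"
    and ann: "\<And>x. x \<in> V \<Longrightarrow> poly_act scale T P x = 0" "\<And>x. x \<in> V \<Longrightarrow> poly_act scale T' P x = 0"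
    and B: "finite B" "V \<subseteq> module.span scale B"
    and vw: "v \<in> V" "v \<noteq> 0" "w \<in> V" "w \<noteq> 0"
  obtains \<sigma> where "bij_betw \<sigma> V V" "\<And>x y. \<lbrakk>x \<in> V; y \<in> V\<rbrakk> \<Longrightarrow> \<sigma> (x + y) = \<sigma> x + \<sigma> y"
    "\<And>x. x \<in> V \<Longrightarrow> \<sigma> (T x) = T' (\<sigma> x)" "\<sigma> v = w"
proof -
  interpret dom: rat_operator scale V T by fact
  interpret ran: rat_operator scale V T' by fact
  let ?graph = "\<lambda>\<Gamma>. annihilated_graph scale V T T' \<Gamma> P"
  have "?graph {(0, 0)}"
    by unfold_locales (use dom.V dom.subspace_0 dom.T_0 ran.T_0 P ann in auto)
  then have 1: "?graph (annihilated_graph.extension scale V T T' {(0, 0)} v w)"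
     and 2: "(v, w) \<in> annihilated_graph.extension scale V T T' {(0, 0)} v w"
    using vw by (auto intro: annihilated_graph.annihilated_extension annihilated_graph.extension_mem)
  define good where "good \<Gamma> \<longleftrightarrow> ?graph \<Gamma> \<and> (v, w) \<in> \<Gamma>" for \<Gamma>
  \<comment> \<open>The bound by \<open>card B\<close> guarantees that a largest dimension is
    attained.\<close>
  have "dom.dim (Domain \<Gamma>) < Suc (card B)" if "good \<Gamma>" for \<Gamma>
  proof -
    interpret annihilated_graph scale V T T' \<Gamma> P using that good_def by simp
    show ?thesis using dom.dim_le_card[of "Domain \<Gamma>" B] B sub by force
  qed
  then obtain \<Gamma> where G: "good \<Gamma>" and max: "\<And>\<Delta>. good \<Delta> \<Longrightarrow> dom.dim (Domain \<Delta>) \<le> dom.dim (Domain \<Gamma>)"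
    using ex_has_greatest_nat[of good "annihilated_graph.extension scale V T T' {(0, 0)} v w"
        "\<lambda>\<Gamma>. dom.dim (Domain \<Gamma>)" "Suc (card B)"] 1 2 good_def by auto
  interpret annihilated_graph scale V T T' \<Gamma> P using G good_def by simp
  have full: "Domain \<Gamma> = V"
  proof (rule ccontr)
    assume ne: "Domain \<Gamma> \<noteq> V"
    then have ne': "Range \<Gamma> \<noteq> V" using Domain_eq_iff_Range_eq[OF B] by simp
    obtain x where x: "x \<in> V" "x \<notin> Domain \<Gamma>" using ne sub by auto
    obtain y where y: "y \<in> V" "y \<notin> Range \<Gamma>" using ne' sub by auto
    let ?E = "extension x y"
    interpret E: annihilated_graph scale V T T' ?E P by (rule annihilated_extension[OF x y])
    have "good ?E" using E.annihilated_graph_axioms extension_superset[of x y] G good_def by auto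
    moreover have "Domain \<Gamma> \<subset> Domain ?E"
      using extension_superset[of x y] extension_mem[OF x(1) y(1)] x by blast
    moreover have "Domain ?E \<subseteq> dom.span B" using E.sub B by auto
    ultimately show False
      using max[of ?E] dom.dim_strict_mono_finite[OF B(1) _ subspace_Domain, of "Domain ?E"] by simp
  qed
  then have full': "Range \<Gamma> = V" using Domain_eq_iff_Range_eq[OF B] by simp
  define \<sigma> where "\<sigma> x = (THE y. (x, y) \<in> \<Gamma>)" for x
  have graph: "(x, \<sigma> x) \<in> \<Gamma>" if "x \<in> V" for x
  proof -
    obtain y where "(x, y) \<in> \<Gamma>" using \<open>x \<in> V\<close> full by blast
    then have "\<exists>!y. (x, y) \<in> \<Gamma>" using graph_fun by (intro ex1I)
    then show ?thesis unfolding \<sigma>_def by (rule theI')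
  qed
  have \<sigma>: "\<sigma> x = y" if "(x, y) \<in> \<Gamma>" for x y
    using graph_fun[OF graph that] that sub by auto
  interpret conv: intertwining_graph scale V T' T "\<Gamma>\<inverse>" by (rule converse_graph)
  show thesis
  proof
    show "bij_betw \<sigma> V V" unfolding bij_betw_def
    proof
      show "inj_on \<sigma> V"
      proof (rule inj_onI)
        fix x y assume "x \<in> V" "y \<in> V" "\<sigma> x = \<sigma> y"
        then show "x = y" using graph[of x] graph[of y] conv.graph_fun[of "\<sigma> x" x y] by simp
      qed
      show "\<sigma> ` V = V"
      proof (intro equalityI subsetI)
        fix y assume "y \<in> V"
        then obtain x where "(x, y) \<in> \<Gamma>" using full' by blast
        then show "y \<in> \<sigma> ` V" using \<sigma>[of x y] full by blast
      next
        fix y assume "y \<in> \<sigma> ` V"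
        then show "y \<in> V" using graph full' by auto
      qed
    qed
    show "\<sigma> (x + y) = \<sigma> x + \<sigma> y" if "x \<in> V" "y \<in> V" for x y
      by (rule \<sigma>) (rule add[OF graph graph, OF that])
    show "\<sigma> (T x) = T' (\<sigma> x)" if "x \<in> V" for x
      by (rule \<sigma>) (rule TT'[OF graph, OF that])
    show "\<sigma> v = w" by (rule \<sigma>) (use G in \<open>simp add: good_def\<close>)
  qed
qed

section \<open>Automorphisms of extensions of rational vector groups\<close>

definition rat_scale :: "rat \<Rightarrow> (nat \<Rightarrow> rat) \<Rightarrow> nat \<Rightarrow> rat" where
  "rat_scale c v = (\<lambda>i. c * v i)"

text \<open>Elements of \<open>rational_power_group n\<close> are \<open>undefined\<close> from n
  on. Replacing that value by 0 makes the group operation pointwise addition and the set a subspace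
  of \<open>nat \<Rightarrow> rat\<close>.\<close>

definition rat_space :: "nat \<Rightarrow> (nat \<Rightarrow> rat) set" where
  "rat_space n = {v. \<forall>i\<ge>n. v i = 0}"

interpretation rat_scale: vector_space rat_scale
  by unfold_locales (auto simp: rat_scale_def fun_eq_iff algebra_simps)

lemma subspace_rat_space: "rat_scale.subspace (rat_space n)"
  by (auto simp: rat_scale.subspace_def rat_space_def rat_scale_def)

lemma finite_spanning_rat_space: obtains B where "finite B" "rat_space n \<subseteq> rat_scale.span B"
proof
  let ?b = "\<lambda>i j. if j = i then 1 else 0 :: rat"
  show "finite (?b ` {..<n})" by simp
  show "rat_space n \<subseteq> rat_scale.span (?b ` {..<n})"
  proof
    fix v assume v: "v \<in> rat_space n"
    have sum_apply: "(\<Sum>i\<in>I. f i) j = (\<Sum>i\<in>I. f i j)" for f :: "nat \<Rightarrow> nat \<Rightarrow> rat" and I j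
      by (induction I rule: infinite_finite_induct) auto
    have "v = (\<Sum>i<n. rat_scale (v i) (?b i))"
    proof
      fix j
      have "(\<Sum>i<n. rat_scale (v i) (?b i)) j = (\<Sum>i<n. if j = i then v i else 0)"
        unfolding sum_apply rat_scale_def by (rule sum.cong) auto
      also have "\<dots> = v j" using v by (simp add: rat_space_def)
      finally show "v j = (\<Sum>i<n. rat_scale (v i) (?b i)) j" ..
    qed
    also have "\<dots> \<in> rat_scale.span (?b ` {..<n})"
      by (intro rat_scale.span_sum rat_scale.span_scale rat_scale.span_base) auto
    finally show "v \<in> rat_scale.span (?b ` {..<n})" .
  qed
qed

lemma carrier_rational_power_group: "carrier (rational_power_group n) = PiE {..<n} (\<lambda>_. UNIV)"
  unfolding rational_power_group_def carrier_sum_group[OF group_rational_group]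
  by (simp add: rational_group_def)

lemma mult_rational_power_group:
  "f \<otimes>\<^bsub>rational_power_group n\<^esub> g = (\<lambda>i\<in>{..<n}. f i + g i)"
  by (simp add: rational_power_group_def rational_group_def)

lemma iso_rational_power_groupE:
  assumes "K \<cong> rational_power_group n"
  obtains e where "bij_betw e (carrier K) (rat_space n)"
    "\<And>a b. \<lbrakk>a \<in> carrier K; b \<in> carrier K\<rbrakk> \<Longrightarrow> e (a \<otimes>\<^bsub>K\<^esub> b) = e a + e b"
proof -
  obtain h where hom: "h \<in> hom K (rational_power_group n)"
    and bij: "bij_betw h (carrier K) (carrier (rational_power_group n))"
    using assms by (auto simp: is_iso_def iso_def)
  let ?z = "\<lambda>f i. if i < n then f i else 0 :: rat"
  have "bij_betw ?z (PiE {..<n} (\<lambda>_. UNIV)) (rat_space n)"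
  proof (rule bij_betw_byWitness[where f' = "\<lambda>v. restrict v {..<n}"])
    show "\<forall>f\<in>PiE {..<n} (\<lambda>_. UNIV). restrict (?z f) {..<n} = f"
    proof
      fix f :: "nat \<Rightarrow> rat" assume f: "f \<in> PiE {..<n} (\<lambda>_. UNIV)"
      show "restrict (?z f) {..<n} = f"
        by (rule ext) (use PiE_arb[OF f] in \<open>simp add: restrict_def\<close>)
    qed
    show "\<forall>v\<in>rat_space n. ?z (restrict v {..<n}) = v"
    proof
      fix v assume "v \<in> rat_space n"
      then show "?z (restrict v {..<n}) = v"
        by (intro ext) (simp add: rat_space_def)
    qed
    show "?z ` PiE {..<n} (\<lambda>_. UNIV) \<subseteq> rat_space n"
      by (rule image_subsetI) (simp add: rat_space_def)
    show "(\<lambda>v. restrict v {..<n}) ` rat_space n \<subseteq> PiE {..<n} (\<lambda>_. UNIV)"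
      by (rule image_subsetI) simp
  qed
  then have "bij_betw (?z \<circ> h) (carrier K) (rat_space n)"
    using bij unfolding carrier_rational_power_group by (rule bij_betw_trans[rotated])
  moreover have "(?z \<circ> h) (a \<otimes>\<^bsub>K\<^esub> b) = (?z \<circ> h) a + (?z \<circ> h) b" if "a \<in> carrier K" "b \<in> carrier K" for a b
    unfolding o_def hom_mult[OF hom that] mult_rational_power_group by (rule ext) simp
  ultimately show thesis by (rule that)
qed

section \<open>Conjugation and automorphisms given by graphs\<close>

context group
begin

definition conjugate :: "'a \<Rightarrow> 'a \<Rightarrow> 'a" where
  "conjugate x a = x \<otimes> a \<otimes> inv x"

lemma conjugate_closed [simp]: "\<lbrakk>x \<in> carrier G; a \<in> carrier G\<rbrakk> \<Longrightarrow> conjugate x a \<in> carrier G"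
  by (simp add: conjugate_def)

lemma conjugate_mult:
  "\<lbrakk>x \<in> carrier G; a \<in> carrier G; b \<in> carrier G\<rbrakk> \<Longrightarrow> conjugate x (a \<otimes> b) = conjugate x a \<otimes> conjugate x b"
  by (simp add: conjugate_def m_assoc inv_solve_left)

lemma conjugate_conjugate:
  "\<lbrakk>x \<in> carrier G; y \<in> carrier G; a \<in> carrier G\<rbrakk> \<Longrightarrow> conjugate x (conjugate y a) = conjugate (x \<otimes> y) a"
  by (simp add: conjugate_def m_assoc inv_mult_group)

lemma conjugate_one [simp]: "a \<in> carrier G \<Longrightarrow> conjugate \<one> a = a" "x \<in> carrier G \<Longrightarrow> conjugate x \<one> = \<one>"
  by (simp_all add: conjugate_def)

lemma conjugate_eq_iff:
  "\<lbrakk>x \<in> carrier G; a \<in> carrier G; b \<in> carrier G\<rbrakk> \<Longrightarrow> conjugate x a = b \<longleftrightarrow> x \<otimes> a = b \<otimes> x"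
  by (metis conjugate_def inv_solve_right m_closed)

lemma conjugate_inj: "\<lbrakk>x \<in> carrier G; a \<in> carrier G; b \<in> carrier G; conjugate x a = conjugate x b\<rbrakk> \<Longrightarrow> a = b"
  by (simp add: conjugate_def)

lemma conjugate_pow:
  "\<lbrakk>x \<in> carrier G; a \<in> carrier G\<rbrakk> \<Longrightarrow> (conjugate x ^^ k) a = conjugate (x [^] k) a"
proof (induction k)
  case (Suc k)
  then show ?case using nat_pow_Suc2[of x k] by (simp add: conjugate_conjugate)
qed simp

text \<open>Closure under inverses is not among the hypotheses: some pair lies over
  \<open>inv a\<close>, and multiplying by it reduces uniqueness of the image of a to uniqueness of
  the image of the identity. Injectivity is dual.\<close>

lemma graph_auto:
  assumes sub: "\<Gamma> \<subseteq> carrier G \<times> carrier G"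
    and dom: "carrier G \<subseteq> Domain \<Gamma>" and ran: "carrier G \<subseteq> Range \<Gamma>"
    and mult: "\<And>a b c d. \<lbrakk>(a, b) \<in> \<Gamma>; (c, d) \<in> \<Gamma>\<rbrakk> \<Longrightarrow> (a \<otimes> c, b \<otimes> d) \<in> \<Gamma>"
    and fst1: "\<And>z. (\<one>, z) \<in> \<Gamma> \<Longrightarrow> z = \<one>" and snd1: "\<And>z. (z, \<one>) \<in> \<Gamma> \<Longrightarrow> z = \<one>"
  obtains f where "f \<in> auto G" "\<And>a b. (a, b) \<in> \<Gamma> \<Longrightarrow> f a = b"
proof -
  have func: "b = c" if ab: "(a, b) \<in> \<Gamma>" and ac: "(a, c) \<in> \<Gamma>" for a b c
  proof -
    have c: "a \<in> carrier G" "b \<in> carrier G" "c \<in> carrier G" using sub ab ac by auto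
    then obtain k where k: "(inv a, k) \<in> \<Gamma>" using dom inv_closed by blast
    then have kc: "k \<in> carrier G" using sub by auto
    have "(\<one>, k \<otimes> b) \<in> \<Gamma>" "(\<one>, k \<otimes> c) \<in> \<Gamma>" using mult[OF k ab] mult[OF k ac] c by auto
    then have "k \<otimes> b = k \<otimes> c" using fst1 by metis
    then show ?thesis using c kc by simp
  qed
  have inj: "a = c" if ab: "(a, b) \<in> \<Gamma>" and cb: "(c, b) \<in> \<Gamma>" for a b c
  proof -
    have c: "a \<in> carrier G" "b \<in> carrier G" "c \<in> carrier G" using sub ab cb by auto
    then obtain k where k: "(k, inv b) \<in> \<Gamma>" using ran inv_closed by blast
    then have kc: "k \<in> carrier G" using sub by auto
    have "(k \<otimes> a, \<one>) \<in> \<Gamma>" "(k \<otimes> c, \<one>) \<in> \<Gamma>" using mult[OF k ab] mult[OF k cb] c by auto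
    then have "k \<otimes> a = k \<otimes> c" using snd1 by metis
    then show ?thesis using c kc by simp
  qed
  \<comment> \<open>The restriction is needed because members of \<open>auto G\<close> are
    extensional on the carrier.\<close>
  define f where "f = (\<lambda>x\<in>carrier G. THE y. (x, y) \<in> \<Gamma>)"
  have f: "f a = b" if "(a, b) \<in> \<Gamma>" for a b
  proof -
    have "(THE y. (a, y) \<in> \<Gamma>) = b" by (rule the_equality) (use that func in auto)
    then show ?thesis using that sub by (auto simp: f_def)
  qed
  have gr: "(a, f a) \<in> \<Gamma>" if a: "a \<in> carrier G" for a
  proof -
    obtain b where "(a, b) \<in> \<Gamma>" using a dom by blast
    then show ?thesis using f by auto
  qed
  have "f ` carrier G = carrier G"
  proof (intro equalityI subsetI)
    fix y assume "y \<in> carrier G"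
    then obtain x where x: "(x, y) \<in> \<Gamma>" using ran by blast
    then have "x \<in> carrier G" using sub by auto
    then show "y \<in> f ` carrier G" using f[OF x] by auto
  next
    fix y assume "y \<in> f ` carrier G"
    then show "y \<in> carrier G" using gr sub by auto
  qed
  moreover have "inj_on f (carrier G)"
  proof (rule inj_onI)
    fix x y assume "x \<in> carrier G" "y \<in> carrier G" "f x = f y"
    then show "x = y" using gr[of x] gr[of y] inj[of x "f x" y] by simp
  qed
  moreover have "f (x \<otimes> y) = f x \<otimes> f y" if "x \<in> carrier G" "y \<in> carrier G" for x y
    by (rule f) (rule mult[OF gr gr, OF that])
  ultimately have "f \<in> auto G"
    by (auto simp: auto_def hom_def Bij_def bij_betw_def f_def)
  then show thesis using f that by blast
qed

lemma prime_card_subgroup: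
  assumes H: "subgroup H G" "card H = p" "Factorial_Ring.prime p" and h: "h \<in> H" "h \<noteq> \<one>"
  shows "ord h = p" "H = {h [^] (k::nat) | k. True}"
proof -
  have hc: "h \<in> carrier G" using subgroup.mem_carrier[OF H(1) h(1)] .
  have fin: "finite H" using H(2,3) by (intro card_ge_0_finite) (simp add: prime_gt_0_nat)
  interpret K: group "G\<lparr>carrier := H\<rparr>" using H(1) by (rule subgroup_imp_group)
  have "h [^]\<^bsub>G\<lparr>carrier := H\<rparr>\<^esub> Coset.order (G\<lparr>carrier := H\<rparr>) = \<one>\<^bsub>G\<lparr>carrier := H\<rparr>\<^esub>"
    by (rule K.pow_order_eq_1) (use h in simp)
  then have "h [^] p = \<one>" using H(2) by (simp add: Coset.order_def nat_pow_consistent[symmetric])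
  then have "ord h dvd p" using hc by (simp add: pow_eq_id)
  then show ord: "ord h = p" using H(3) h(2) ord_eq_1[OF hc] by (auto simp: prime_nat_iff)
  have "ord h \<noteq> 0" using ord H(3) by auto
  then have gen: "{h [^] (k::nat) | k. True} = generate G {h}"
    using generate_pow_nat[OF hc] by simp
  have "generate G {h} \<subseteq> H" using h H(1) by (intro generate_subgroup_incl) auto
  moreover have "card (generate G {h}) = card H" using generate_pow_card[OF hc] ord H(2) by simp
  ultimately have "generate G {h} = H" by (rule card_subset_eq[OF fin])
  then show "H = {h [^] (k::nat) | k. True}" using gen by simp
qed

end

text \<open>A form of the semidirect product that singles out no complement: every x outside A
  generates one. Two such elements x and y can therefore be treated alike.\<close>

locale prime_fpf_extension = group G for G :: "('a, 'b) monoid_scheme" (structure) +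
  fixes A :: "'a set" and p :: nat
  assumes normal: "A \<lhd> G"
    and commute: "\<lbrakk>a \<in> A; b \<in> A\<rbrakk> \<Longrightarrow> a \<otimes> b = b \<otimes> a"
    and p: "Factorial_Ring.prime p"
    and fpf: "\<lbrakk>x \<in> carrier G; x \<notin> A; a \<in> A; conjugate x a = a\<rbrakk> \<Longrightarrow> a = \<one>"
    and pow_mem_iff: "\<lbrakk>x \<in> carrier G; x \<notin> A\<rbrakk> \<Longrightarrow> x [^] k \<in> A \<longleftrightarrow> p dvd k"
    and decompose: "\<lbrakk>x \<in> carrier G; x \<notin> A; g \<in> carrier G\<rbrakk> \<Longrightarrow> \<exists>a\<in>A. \<exists>k::nat. g = a \<otimes> x [^] k"
begin

lemma subgroup_A: "subgroup A G" using normal by (rule normal_imp_subgroup)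

lemma A_carrier: "a \<in> A \<Longrightarrow> a \<in> carrier G" by (rule subgroup.mem_carrier[OF subgroup_A])

lemma conjugate_A: "\<lbrakk>x \<in> carrier G; a \<in> A\<rbrakk> \<Longrightarrow> conjugate x a \<in> A"
  unfolding conjugate_def by (rule normal.inv_op_closed2[OF normal])

text \<open>The power lies in A and commutes with x, so it is a fixed point of conjugation by
  x.\<close>

lemma pow_p: assumes "x \<in> carrier G" "x \<notin> A" shows "x [^] p = \<one>"
proof (rule fpf[OF assms])
  show "x [^] p \<in> A" using pow_mem_iff assms by simp
  show "conjugate x (x [^] p) = x [^] p"
    using assms(1) nat_pow_Suc2[of x p] by (simp add: conjugate_eq_iff)
qed

text \<open>The automorphism sends a x^k to s(a) y^k. It is well defined and injective because x and
  y have the same order p, both in G and modulo A.\<close>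

lemma intertwiner_auto:
  assumes x: "x \<in> carrier G" "x \<notin> A" and y: "y \<in> carrier G" "y \<notin> A"
    and s: "bij_betw s A A" "\<And>a b. \<lbrakk>a \<in> A; b \<in> A\<rbrakk> \<Longrightarrow> s (a \<otimes> b) = s a \<otimes> s b"
    and sc: "\<And>a. a \<in> A \<Longrightarrow> s (conjugate x a) = conjugate y (s a)"
  obtains f where "f \<in> auto G" "f x = y" "\<And>a. a \<in> A \<Longrightarrow> f a = s a"
proof -
  interpret A: subgroup A G by (rule subgroup_A)
  have sA: "s a \<in> A" if "a \<in> A" for a using s(1) that bij_betwE by blast
  have s1: "s \<one> = \<one>" using s(2)[of \<one> \<one>] A_carrier[OF sA[of \<one>]] by simp
  have sck: "s (conjugate (x [^] k) a) = conjugate (y [^] k) (s a)" if "a \<in> A" for k :: nat and a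
    using that
  proof (induction k)
    case 0
    then show ?case using A_carrier sA by simp
  next
    case (Suc k)
    have "s (conjugate (x [^] Suc k) a) = s (conjugate x (conjugate (x [^] k) a))"
      using x Suc A_carrier nat_pow_Suc2[of x k] by (simp add: conjugate_conjugate)
    also have "\<dots> = conjugate y (conjugate (y [^] k) (s a))"
      using Suc x sc conjugate_A by simp
    also have "\<dots> = conjugate (y [^] Suc k) (s a)"
      using Suc.prems y A_carrier sA nat_pow_Suc2[of y k]
      by (simp add: conjugate_conjugate)
    finally show ?case .
  qed
  define \<Gamma> where "\<Gamma> = {(a \<otimes> x [^] k, s a \<otimes> y [^] k) | a (k::nat). a \<in> A}"
  have mem: "(a \<otimes> x [^] k, s a \<otimes> y [^] k) \<in> \<Gamma>" if "a \<in> A" for a and k :: nat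
    using that unfolding \<Gamma>_def by blast
  have mem_E: "\<exists>a (k::nat). a \<in> A \<and> g = a \<otimes> x [^] k \<and> h = s a \<otimes> y [^] k" if "(g, h) \<in> \<Gamma>" for g h
    using that unfolding \<Gamma>_def mem_Collect_eq prod.inject by blast
  \<comment> \<open>Stated for z equal to x or to y, so that it covers both the pairs with first
    component 1 and those with second component 1.\<close>
  have triv: "x [^] k = \<one> \<and> y [^] k = \<one> \<and> a = \<one>"
    if a: "a \<in> A" and eq: "a \<otimes> z [^] k = \<one>" and z: "z = x \<or> z = y" for a z and k :: nat
  proof -
    have zc: "z \<in> carrier G" "z \<notin> A" using z x y by auto
    have "inv (z [^] k) = a" by (rule inv_equality[OF eq]) (use zc A_carrier[OF a] in simp_all)
    then have "inv a = z [^] k" using zc(1) by force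
    moreover have "inv a \<in> A" using a by simp
    ultimately have "z [^] k \<in> A" by simp
    then have "p dvd k" using pow_mem_iff[OF zc] by simp
    then obtain m where k: "k = p * m" by (elim dvdE)
    have one: "u [^] k = \<one>" if "u \<in> carrier G" "u \<notin> A" for u
      using nat_pow_pow[OF that(1), of p m] pow_p[OF that] by (simp add: k)
    have "a = \<one>" using eq one[OF zc] A_carrier[OF a] by simp
    then show ?thesis using one[OF x] one[OF y] by simp
  qed
  obtain f where f: "f \<in> auto G" "\<And>a b. (a, b) \<in> \<Gamma> \<Longrightarrow> f a = b"
  proof (rule graph_auto[of \<Gamma>])
    show "\<Gamma> \<subseteq> carrier G \<times> carrier G" 
    proof
      fix z assume "z \<in> \<Gamma>"
      then obtain a k where "a \<in> A" "z = (a \<otimes> x [^] (k::nat), s a \<otimes> y [^] k)"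
        unfolding \<Gamma>_def by blast
      then show "z \<in> carrier G \<times> carrier G" using x y sA A_carrier by simp
    qed
    show "carrier G \<subseteq> Domain \<Gamma>" 
    proof
      fix g assume "g \<in> carrier G"
      then obtain a k where "a \<in> A" "g = a \<otimes> x [^] (k::nat)" using decompose[OF x] by blast
      then show "g \<in> Domain \<Gamma>" using mem[of a k] by auto
    qed
    show "carrier G \<subseteq> Range \<Gamma>"
    proof
      fix g assume "g \<in> carrier G"
      then obtain b k where b: "b \<in> A" "g = b \<otimes> y [^] (k::nat)" using decompose[OF y] by blast
      have "b \<in> s ` A" using s(1) b(1) by (simp add: bij_betw_def)
      then obtain a where "a \<in> A" "s a = b" by blast
      then show "g \<in> Range \<Gamma>" using mem[of a k] b by auto
    qed
    show "(g \<otimes> h, g' \<otimes> h') \<in> \<Gamma>" if g: "(g, g') \<in> \<Gamma>" and h: "(h, h') \<in> \<Gamma>" for g g' h h'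
    proof -
      obtain a k where a: "a \<in> A" "g = a \<otimes> x [^] (k::nat)" "g' = s a \<otimes> y [^] k" using mem_E[OF g] by (elim exE conjE)
      obtain b l where b: "b \<in> A" "h = b \<otimes> x [^] (l::nat)" "h' = s b \<otimes> y [^] l" using mem_E[OF h] by (elim exE conjE)
      \<comment> \<open>Collects the powers of z on the right, at the price of conjugating
        v.\<close>
      have swap: "(u \<otimes> z [^] k) \<otimes> (v \<otimes> z [^] l) = (u \<otimes> conjugate (z [^] k) v) \<otimes> z [^] (k + l)"
        if "u \<in> carrier G" "v \<in> carrier G" "z \<in> carrier G" for u v z
      proof -
        have "inv (z [^] k) \<otimes> (z [^] k \<otimes> z [^] l) = z [^] l"
          using that by (simp flip: m_assoc)
        then show ?thesis
          unfolding nat_pow_mult[OF that(3), of k l, symmetric] conjugate_def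
          using that by (simp add: m_assoc)
      qed
      have c: "conjugate (x [^] k) b \<in> A" using b x conjugate_A by simp
      have "g \<otimes> h = (a \<otimes> conjugate (x [^] k) b) \<otimes> x [^] (k + l)"
        unfolding a b by (rule swap[OF A_carrier[OF a(1)] A_carrier[OF b(1)] x(1)])
      moreover have "g' \<otimes> h' = s (a \<otimes> conjugate (x [^] k) b) \<otimes> y [^] (k + l)"
        unfolding a b s(2)[OF a(1) c] sck[OF b(1)]
        by (rule swap[OF A_carrier[OF sA[OF a(1)]] A_carrier[OF sA[OF b(1)]] y(1)])
      ultimately show ?thesis
        using mem[OF A.m_closed[OF a(1) c], of "k + l"] by (simp only:)
    qed
    show "z = \<one>" if 1: "(\<one>, z) \<in> \<Gamma>" for z
    proof -
      obtain a k where a: "a \<in> A" "\<one> = a \<otimes> x [^] (k::nat)" "z = s a \<otimes> y [^] k" using mem_E[OF 1] by (elim exE conjE)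
      have "y [^] k = \<one>" "a = \<one>" using triv[OF a(1) a(2)[symmetric]] by auto
      then show ?thesis using a(3) s1 by simp
    qed
    show "z = \<one>" if 1: "(z, \<one>) \<in> \<Gamma>" for z
    proof -
      obtain a k where a: "a \<in> A" "z = a \<otimes> x [^] (k::nat)" "\<one> = s a \<otimes> y [^] k" using mem_E[OF 1] by (elim exE conjE)
      have *: "x [^] k = \<one>" "s a = \<one>" using triv[OF sA[OF a(1)] a(3)[symmetric]] by auto
      have "a = \<one>" 
        using inj_onD[OF bij_betw_imp_inj_on[OF s(1)], of a \<one>] s1 a(1) *(2) by simp
      then show ?thesis using a(2) *(1) by simp
    qed
  qed (rule that)
  have "f x = y" using f(2)[OF mem[of \<one> 1]] x y s1 by simp
  moreover have "f a = s a" if "a \<in> A" for a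
    using f(2)[OF mem[OF that, of 0]] that A_carrier sA by simp
  ultimately show thesis using f(1) that by blast
qed


text \<open>Prescribing both images lets one statement serve both nontrivial orbits: keep v fixed to
  move elements outside A, keep x fixed to move elements of A.\<close>

lemma orbit_transitive:
  assumes e: "bij_betw e A (rat_space n)" "\<And>a b. \<lbrakk>a \<in> A; b \<in> A\<rbrakk> \<Longrightarrow> e (a \<otimes> b) = e a + e b"
    and x: "x \<in> carrier G" "x \<notin> A" and y: "y \<in> carrier G" "y \<notin> A"
    and v: "v \<in> A" "v \<noteq> \<one>" and w: "w \<in> A" "w \<noteq> \<one>"
  obtains f where "f \<in> auto G" "f x = y" "f v = w"
proof -
  interpret A: subgroup A G by (rule subgroup_A)
  define d where "d = inv_into A e"
  have ed: "e (d u) = u" "d u \<in> A" if "u \<in> rat_space n" for u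
    using that e(1) unfolding d_def by (auto simp: bij_betw_def f_inv_into_f inv_into_into)
  have de: "d (e a) = a" "e a \<in> rat_space n" if "a \<in> A" for a
    using that e(1) unfolding d_def by (auto simp: bij_betw_def)
  have e1: "e \<one> = 0" using e(2)[of \<one> \<one>] by simp
  have dadd: "d (u + v) = d u \<otimes> d v" if "u \<in> rat_space n" "v \<in> rat_space n" for u v
    using ed(1)[OF that(1)] ed(1)[OF that(2)] e(2)[OF ed(2)[OF that(1)] ed(2)[OF that(2)]]
      de(1)[of "d u \<otimes> d v"] ed(2)[OF that(1)] ed(2)[OF that(2)] by auto
  \<comment> \<open>Conjugation by z transported along e to the rational space; by
    \<open>pow_p\<close> and freeness of the action it has period p and no nonzero fixed vector if z
    lies outside A.\<close>
  define T where "T z = e \<circ> conjugate z \<circ> d" for z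
  have Te: "T z (e a) = e (conjugate z a)" if "a \<in> A" for z a
    using that by (simp add: T_def de)
  have op: "rat_operator rat_scale (rat_space n) (T z)" if z: "z \<in> carrier G" for z
  proof unfold_locales
    show "rat_scale.subspace (rat_space n)" by (rule subspace_rat_space)
    show "T z u \<in> rat_space n" if "u \<in> rat_space n" for u
      using z that by (simp add: T_def ed de conjugate_A)
    show "T z (u + v) = T z u + T z v" if "u \<in> rat_space n" "v \<in> rat_space n" for u v
      using z that by (simp add: T_def dadd ed conjugate_mult A_carrier conjugate_A e(2))
  qed
  have Tpow: "(T z ^^ k) (e a) = e (conjugate (z [^] k) a)"
    if "a \<in> A" "z \<in> carrier G" for z a and k :: nat
    using that
  proof (induction k)
    case (Suc k)
    then have "(T z ^^ Suc k) (e a) = e (conjugate z (conjugate (z [^] k) a))"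
      by (simp add: Te conjugate_A)
    then show ?case
      using Suc.prems A_carrier nat_pow_Suc2[of z k] by (simp add: conjugate_conjugate)
  qed (simp add: A_carrier)
  have ann: "poly_act rat_scale (T z) (cyclotomic_prime p) u = 0"
    if z: "z \<in> carrier G" "z \<notin> A" and u: "u \<in> rat_space n" for z u
  proof -
    interpret rat_operator rat_scale "rat_space n" "T z" using op z(1) .
    show ?thesis
    proof (rule act_cyclotomic_prime[OF _ _ _ u])
      show "(T z ^^ p) u = u" if "u \<in> rat_space n" for u
        using Tpow[OF ed(2)[OF that] z(1), of p] ed[OF that] pow_p[OF z] A_carrier by simp
      show "u = 0" if "u \<in> rat_space n" "T z u = u" for u
      proof -
        have "e (conjugate z (d u)) = u" using that by (simp add: T_def)
        then have "conjugate z (d u) = d u" using de(1)[of "conjugate z (d u)"] conjugate_A z ed that by auto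
        then have "d u = \<one>" using fpf[OF z] ed that by blast
        then show "u = 0" using ed(1)[OF that(1)] e1 by simp
      qed
      show "p > 0" using p by (simp add: prime_gt_0_nat)
    qed
  qed
  have ne: "e a \<noteq> 0" if "a \<in> A" "a \<noteq> \<one>" for a
    using that de(1)[of a] de(1)[of \<one>] e1 by auto
  obtain B where B: "finite B" "rat_space n \<subseteq> rat_scale.span B" using finite_spanning_rat_space .
  have P: "prime_elem (cyclotomic_prime p)"
    using irreducible_cyclotomic_prime[OF p] by (rule irreducible_imp_prime_elem_gcd)
  have P': "degree (cyclotomic_prime p) > 0"
    using p by (simp add: degree_cyclotomic_prime prime_gt_Suc_0_nat)
  obtain \<sigma> where \<sigma>: "bij_betw \<sigma> (rat_space n) (rat_space n)"
    "\<And>u v. \<lbrakk>u \<in> rat_space n; v \<in> rat_space n\<rbrakk> \<Longrightarrow> \<sigma> (u + v) = \<sigma> u + \<sigma> v"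
    "\<And>u. u \<in> rat_space n \<Longrightarrow> \<sigma> (T x u) = T y (\<sigma> u)" "\<sigma> (e v) = e w"
    using intertwiner_exists[OF op[OF x(1)] op[OF y(1)] P P' ann[OF x] ann[OF y] B
        de(2)[OF v(1)] ne[OF v] de(2)[OF w(1)] ne[OF w]] by blast
  have \<sigma>V: "\<sigma> u \<in> rat_space n" if "u \<in> rat_space n" for u using \<sigma>(1) that bij_betwE by blast
  have bd: "bij_betw d (rat_space n) A" unfolding d_def by (rule bij_betw_inv_into[OF e(1)])
  show thesis
  proof (rule intertwiner_auto[OF x y, of "d \<circ> \<sigma> \<circ> e"])
    show "bij_betw (d \<circ> \<sigma> \<circ> e) A A" 
      by (rule bij_betw_trans[OF bij_betw_trans[OF e(1) \<sigma>(1)] bd, unfolded comp_assoc[symmetric]])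
    show "(d \<circ> \<sigma> \<circ> e) (a \<otimes> b) = (d \<circ> \<sigma> \<circ> e) a \<otimes> (d \<circ> \<sigma> \<circ> e) b" if "a \<in> A" "b \<in> A" for a b
      using that by (simp add: e(2) \<sigma>(2) de dadd \<sigma>V)
    show "(d \<circ> \<sigma> \<circ> e) (conjugate x a) = conjugate y ((d \<circ> \<sigma> \<circ> e) a)" if a: "a \<in> A" for a
    proof -
      have "(d \<circ> \<sigma> \<circ> e) (conjugate x a) = d (\<sigma> (T x (e a)))" using a by (simp add: Te)
      also have "\<dots> = d (T y (\<sigma> (e a)))" using a by (simp add: \<sigma>(3) de)
      also have "\<dots> = conjugate y (d (\<sigma> (e a)))"
        using a y by (simp add: T_def de ed \<sigma>V conjugate_A)
      finally show ?thesis by simp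
    qed
    fix f assume "f \<in> auto G" "f x = y" and fs: "\<And>a. a \<in> A \<Longrightarrow> f a = (d \<circ> \<sigma> \<circ> e) a"
    moreover have "f v = w" using fs[OF v(1)] w \<sigma>(4) de by simp
    ultimately show thesis using that by blast
  qed
qed

end

section \<open>Automorphism orbits of the semidirect product\<close>

context group
begin

lemma subgroup_nat_pow_closed:
  assumes "subgroup H G" "h \<in> H"
  shows "h [^] (k::nat) \<in> H"
  using subgroup_int_pow_closed[OF assms, of "int k"] by (simp add: int_pow_int)

abbreviation aut_orbit :: "'a \<Rightarrow> 'a set" where
  "aut_orbit \<equiv> orbit (AutoGroup G) (\<lambda>f. f)"

lemma carrier_AutoGroup [simp]: "carrier (AutoGroup G) = auto G"
  by (simp add: AutoGroup_def)

lemma aut_orbit_mem_iff: "y \<in> aut_orbit x \<longleftrightarrow> (\<exists>f\<in>auto G. f x = y)"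
  by (auto simp: orbit_def)

lemma num_aut_orbits_eq: "num_aut_orbits G = card (aut_orbit ` carrier G)"
  unfolding num_aut_orbits_def orbits_def by (rule arg_cong[of _ _ card]) blast

lemma group_action_AutoGroup: "group_action (AutoGroup G) (carrier G) (\<lambda>f. f)"
proof -
  have "(\<lambda>f. f) \<in> hom (AutoGroup G) (BijGroup (carrier G))"
    using subgroup.subset[OF subgroup_auto] by (auto simp: hom_def AutoGroup_def)
  then show ?thesis
    by (simp add: group_action_def group_hom_def group_hom_axioms_def AutoGroup group_BijGroup)
qed

lemma aut_orbit_refl: "x \<in> carrier G \<Longrightarrow> x \<in> aut_orbit x"
  using group_action.orbit_refl[OF group_action_AutoGroup] .

lemma aut_orbit_eq:
  assumes "x \<in> carrier G" "f \<in> auto G"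
  shows "aut_orbit (f x) = aut_orbit x"
proof -
  interpret group_action "AutoGroup G" "carrier G" "\<lambda>f. f" by (rule group_action_AutoGroup)
  have fx: "f x \<in> carrier G" using element_image[of f x] assms by simp
  have mem: "f x \<in> aut_orbit x" using assms by (auto simp: aut_orbit_mem_iff)
  have closed: "aut_orbit z \<subseteq> carrier G" if "z \<in> carrier G" for z
    using element_image that by (auto simp: aut_orbit_mem_iff)
  show ?thesis
  proof (intro equalityI subsetI)
    fix z assume "z \<in> aut_orbit (f x)"
    then show "z \<in> aut_orbit x" using orbit_trans[OF assms(1) fx _ mem] closed[OF fx] by blast
  next
    fix z assume "z \<in> aut_orbit x"
    then show "z \<in> aut_orbit (f x)"
      using orbit_trans[OF fx assms(1) _ orbit_sym[OF assms(1) fx mem]] closed[OF assms(1)] by blast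
  qed
qed

lemma autoD:
  assumes "f \<in> auto G"
  shows "f \<in> hom G G" "bij_betw f (carrier G) (carrier G)" "group_hom G G f"
  using assms is_group
  by (auto simp: auto_def Bij_def group_hom_def group_hom_axioms_def)

lemma auto_closed: "\<lbrakk>f \<in> auto G; x \<in> carrier G\<rbrakk> \<Longrightarrow> f x \<in> carrier G"
  using autoD(1) hom_in_carrier by metis

lemma auto_nat_pow: "\<lbrakk>f \<in> auto G; x \<in> carrier G\<rbrakk> \<Longrightarrow> f (x [^] (n::nat)) = f x [^] n"
  using group_hom.hom_nat_pow[OF autoD(3)] by metis

lemma auto_one: "f \<in> auto G \<Longrightarrow> f \<one> = \<one>"
  using group_hom.hom_one[OF autoD(3)] .

lemma auto_eq_one_iff:
  assumes "f \<in> auto G" "x \<in> carrier G"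
  shows "f x = \<one> \<longleftrightarrow> x = \<one>"
  using inj_on_eq_iff[OF bij_betw_imp_inj_on[OF autoD(2)[OF assms(1)]] assms(2) one_closed]
  by (simp add: auto_one assms)

lemma auto_ord:
  assumes "f \<in> auto G" "x \<in> carrier G"
  shows "ord (f x) = ord x"
proof -
  have "f x [^] n = \<one> \<longleftrightarrow> ord x dvd n" for n :: nat
    using auto_eq_one_iff[OF assms(1), of "x [^] n"] auto_nat_pow[OF assms, of n] pow_eq_id[OF assms(2), of n]
      assms(2) by simp
  then show ?thesis using ord_unique[OF auto_closed[OF assms]] by blast
qed

text \<open>Automorphisms preserve orders, so the orbits of the identity, x and y are distinct in
  any case. Having exactly three orbits means that these exhaust the group.\<close>

lemma num_aut_orbits_eq_3:
  assumes x: "x \<in> carrier G" "x \<noteq> \<one>" "ord x \<noteq> 0" and y: "y \<in> carrier G" "ord y = 0"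
  shows "num_aut_orbits G = 3 \<longleftrightarrow>
    (\<forall>z\<in>carrier G. z \<noteq> \<one> \<longrightarrow> ord z \<noteq> 0 \<longrightarrow> (\<exists>f\<in>auto G. f x = z)) \<and>
    (\<forall>z\<in>carrier G. ord z = 0 \<longrightarrow> (\<exists>f\<in>auto G. f y = z))" (is "_ \<longleftrightarrow> ?R")
proof -
  let ?O = "{aut_orbit \<one>, aut_orbit x, aut_orbit y}"
  have y1: "y \<noteq> \<one>" using y(2) ord_id by auto
  have n1: "x \<notin> aut_orbit \<one>" "y \<notin> aut_orbit \<one>"
    using x(2) y1 auto_one by (auto simp: aut_orbit_mem_iff)
  have n2: "y \<notin> aut_orbit x" using auto_ord[OF _ x(1)] x(3) y(2) by (auto simp: aut_orbit_mem_iff)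
  have refl: "x \<in> aut_orbit x" "y \<in> aut_orbit y" using x y aut_orbit_refl by auto
  have ne: "aut_orbit \<one> \<noteq> aut_orbit x" "aut_orbit \<one> \<noteq> aut_orbit y" "aut_orbit x \<noteq> aut_orbit y"
    using n1 n2 refl by metis+
  then have card: "card ?O = 3" by simp
  have sub: "?O \<subseteq> aut_orbit ` carrier G" using x y by blast
  show ?thesis
  proof
    assume 3: "num_aut_orbits G = 3"
    \<comment> \<open>A nonzero cardinality excludes the infinite case, where \<open>card\<close> is
      0.\<close>
    then have "finite (aut_orbit ` carrier G)" unfolding num_aut_orbits_eq by (intro card_ge_0_finite) simp
    then have eq: "?O = aut_orbit ` carrier G"
      using card_subset_eq[OF _ sub] 3 card unfolding num_aut_orbits_eq by simp
    have cases: "z \<in> aut_orbit \<one> \<or> z \<in> aut_orbit x \<or> z \<in> aut_orbit y" if "z \<in> carrier G" for z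
    proof -
      have "aut_orbit z \<in> ?O" using that eq by blast
      then show ?thesis using aut_orbit_refl[OF that] by auto
    qed
    show ?R
    proof (intro conjI ballI impI)
      fix z assume z: "z \<in> carrier G" "z \<noteq> \<one>" "ord z \<noteq> 0"
      have "z \<notin> aut_orbit \<one>" "z \<notin> aut_orbit y"
        using z auto_one auto_ord[OF _ y(1)] y(2) by (auto simp: aut_orbit_mem_iff)
      then show "\<exists>f\<in>auto G. f x = z" using cases[OF z(1)] by (simp add: aut_orbit_mem_iff)
    next
      fix z assume z: "z \<in> carrier G" "ord z = 0"
      have "z \<noteq> \<one>" using z by auto
      then have "z \<notin> aut_orbit \<one>" "z \<notin> aut_orbit x"
        using z auto_one auto_ord[OF _ x(1)] x(3) ord_id by (auto simp: aut_orbit_mem_iff)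
      then show "\<exists>f\<in>auto G. f y = z" using cases[OF z(1)] by (simp add: aut_orbit_mem_iff)
    qed
  next
    assume R: ?R
    have "aut_orbit z \<in> ?O" if z: "z \<in> carrier G" for z
    proof -
      consider "z = \<one>" | "z \<noteq> \<one>" "ord z \<noteq> 0" | "ord z = 0" by blast
      then show ?thesis
      proof cases
        case 2
        then obtain f where "f \<in> auto G" "f x = z" using R z by blast
        then show ?thesis using aut_orbit_eq[OF x(1)] by auto
      next
        case 3
        then obtain f where "f \<in> auto G" "f y = z" using R z by blast
        then show ?thesis using aut_orbit_eq[OF y(1)] by auto
      qed simp
    qed
    then have "aut_orbit ` carrier G = ?O" using sub by blast
    then show "num_aut_orbits G = 3" unfolding num_aut_orbits_eq using card by simp
  qed
qed

text \<open>Write x = a h. As A is abelian, a h acts on A as h does, and the powers of a h and of h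
  agree up to a factor in A; so every property passes from h to x.\<close>

lemma prime_fpf_extensionI:
  assumes sd: "internal_semidirect G A H" and p: "card H = p" "Factorial_Ring.prime p"
    and fpf: "fixed_point_free_conj G H A"
    and comm: "\<And>a b. \<lbrakk>a \<in> A; b \<in> A\<rbrakk> \<Longrightarrow> a \<otimes> b = b \<otimes> a"
  shows "prime_fpf_extension G A p"
proof -
  have A: "A \<lhd> G" and H: "subgroup H G" and int: "A \<inter> H = {\<one>}" and AH: "A <#> H = carrier G"
    using sd by (auto simp: internal_semidirect_def)
  interpret A: normal A G by (rule A)
  interpret H: subgroup H G by (rule H)
  have decomp: "\<exists>a\<in>A. \<exists>h\<in>H. g = a \<otimes> h" if "g \<in> carrier G" for g
    using that unfolding AH[symmetric] set_mult_def by blast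
  have pow: "\<exists>b\<in>A. (a \<otimes> h) [^] k = b \<otimes> h [^] k" if "a \<in> A" "h \<in> H" for a h and k :: nat
  proof (induction k)
    case (Suc k)
    then obtain b where b: "b \<in> A" "(a \<otimes> h) [^] k = b \<otimes> h [^] k" by blast
    have c: "h [^] k \<otimes> a \<otimes> inv (h [^] k) \<in> A" using that by (intro A.inv_op_closed2) auto
    have "(a \<otimes> h) [^] Suc k = (b \<otimes> (h [^] k \<otimes> a \<otimes> inv (h [^] k))) \<otimes> h [^] Suc k"
    proof -
      have "inv (h [^] k) \<otimes> (h [^] k \<otimes> h) = h" using that by (simp flip: m_assoc)
      then show ?thesis using b that by (simp add: m_assoc)
    qed
    then show ?case using b(1) c A.m_closed by blast
  qed (use A.one_closed in auto)
  have split: "\<exists>a\<in>A. \<exists>h\<in>H. x = a \<otimes> h \<and> h \<noteq> \<one>" if x: "x \<in> carrier G" "x \<notin> A" for x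
  proof -
    obtain a h where ah: "a \<in> A" "h \<in> H" "x = a \<otimes> h" using decomp[OF x(1)] by blast
    then have "h \<noteq> \<one>" using x(2) by auto
    then show ?thesis using ah by blast
  qed
  show ?thesis
  proof (intro prime_fpf_extension.intro[OF is_group] prime_fpf_extension_axioms.intro A p(2) comm)
    fix x c assume x: "x \<in> carrier G" "x \<notin> A" and c: "c \<in> A" "conjugate x c = c"
    obtain a h where ah: "a \<in> A" "h \<in> H" "x = a \<otimes> h" "h \<noteq> \<one>" using split[OF x] by blast
    have k: "conjugate h c \<in> A" unfolding conjugate_def by (rule A.inv_op_closed2) (use ah c in auto)
    have "conjugate x c = conjugate a (conjugate h c)"
      using ah c by (simp add: conjugate_conjugate)
    also have "\<dots> = conjugate h c"
      using comm[OF ah(1) k] ah(1) k by (simp add: conjugate_eq_iff)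
    finally have "conjugate h c = c" using c by simp
    then show "c = \<one>" using fpf ah c unfolding fixed_point_free_conj_def conjugate_def by blast
  next
    fix x and k :: nat assume x: "x \<in> carrier G" "x \<notin> A"
    obtain a h where ah: "a \<in> A" "h \<in> H" "x = a \<otimes> h" "h \<noteq> \<one>" using split[OF x] by blast
    obtain b where b: "b \<in> A" "x [^] k = b \<otimes> h [^] k" using pow[OF ah(1,2)] ah(3) by blast
    have hk: "h [^] k \<in> H" using ah(2) by (rule subgroup_nat_pow_closed[OF H])
    have "x [^] k \<in> A \<longleftrightarrow> h [^] k \<in> A"
    proof
      assume "x [^] k \<in> A"
      then have "inv b \<otimes> x [^] k \<in> A" using b(1) by simp
      moreover have "inv b \<otimes> x [^] k = h [^] k" unfolding b(2) using b(1) ah(2) by (simp flip: m_assoc)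
      ultimately show "h [^] k \<in> A" by simp
    qed (use b in simp)
    also have "\<dots> \<longleftrightarrow> h [^] k = \<one>" using hk int A.one_closed by auto
    also have "\<dots> \<longleftrightarrow> p dvd k"
      using prime_card_subgroup(1)[OF H p ah(2,4)] pow_eq_id[of h k] ah(2) by simp
    finally show "x [^] k \<in> A \<longleftrightarrow> p dvd k" .
  next
    fix x g assume x: "x \<in> carrier G" "x \<notin> A" and g: "g \<in> carrier G"
    obtain a h where ah: "a \<in> A" "h \<in> H" "x = a \<otimes> h" "h \<noteq> \<one>" using split[OF x] by blast
    obtain c l where c: "c \<in> A" "l \<in> H" "g = c \<otimes> l" using decomp[OF g] by blast
    obtain k :: nat where k: "l = h [^] k" using prime_card_subgroup(2)[OF H p ah(2,4)] c(2) by blast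
    obtain b where b: "b \<in> A" "x [^] k = b \<otimes> h [^] k" using pow[OF ah(1,2)] ah(3) by blast
    have "inv b \<otimes> x [^] k = h [^] k" unfolding b(2) using b(1) ah(2) by (simp flip: m_assoc)
    then have "g = (c \<otimes> inv b) \<otimes> x [^] k" using c b(1) k x by (simp add: m_assoc)
    moreover have "c \<otimes> inv b \<in> A" using b(1) c(1) by simp
    ultimately show "\<exists>a\<in>A. \<exists>k::nat. g = a \<otimes> x [^] k" by blast
  qed
qed

text \<open>Orders separate A from its complement: nontrivial elements of A have infinite order and
  elements outside A have order p.\<close>

theorem num_aut_orbits_semidirect:
  assumes sd: "internal_semidirect G A H" and cardH: "card H = p" and prime_p: "Factorial_Ring.prime p"
    and fpf: "fixed_point_free_conj G H A"
    and iso: "G\<lparr>carrier := A\<rparr> \<cong> rational_power_group n" and n: "n > 0"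
  shows "num_aut_orbits G = 3"
proof -
  have A: "A \<lhd> G" and H: "subgroup H G" and int: "A \<inter> H = {\<one>}"
    using sd by (auto simp: internal_semidirect_def)
  interpret A: normal A G by (rule A)
  interpret H: subgroup H G by (rule H)
  obtain e where e: "bij_betw e A (rat_space n)" "\<And>a b. \<lbrakk>a \<in> A; b \<in> A\<rbrakk> \<Longrightarrow> e (a \<otimes> b) = e a + e b"
    using iso_rational_power_groupE[OF iso] by auto
  have inj: "a = b" if "a \<in> A" "b \<in> A" "e a = e b" for a b
    using inj_onD[OF bij_betw_imp_inj_on[OF e(1)]] that by blast
  have "a \<otimes> b = b \<otimes> a" if "a \<in> A" "b \<in> A" for a b
    by (rule inj) (use that in \<open>simp_all add: e(2) add.commute\<close>)
  then interpret prime_fpf_extension G A p by (rule prime_fpf_extensionI[OF sd cardH prime_p fpf])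
  have e1: "e \<one> = 0" using e(2)[of \<one> \<one>] by simp
  have epow: "e (a [^] k) = (\<lambda>i. of_nat k * e a i)" if "a \<in> A" for a and k :: nat
  proof (induction k)
    case (Suc k)
    have "a [^] k \<in> A" using that by (rule subgroup_nat_pow_closed[OF subgroup_A])
    then show ?case using that Suc by (simp add: e(2) fun_eq_iff algebra_simps)
  qed (simp add: e1 fun_eq_iff)
  have tf: "ord a = 0" if a: "a \<in> A" "a \<noteq> \<one>" for a
  proof -
    obtain i where i: "e a i \<noteq> 0" using inj[OF a(1) A.one_closed] a e1 by (auto simp: fun_eq_iff)
    have "e (a [^] ord a) i = e \<one> i" using pow_ord_eq_1[of a] a A_carrier by simp
    then have "of_nat (ord a) * e a i = 0" using epow[OF a(1)] e1 by simp
    then show ?thesis using i by simp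
  qed
  have ordp: "ord z = p" if z: "z \<in> carrier G" "z \<notin> A" for z
  proof -
    have "z \<noteq> \<one>" using z by auto
    then show ?thesis
      using pow_p[OF z] pow_eq_id[OF z(1), of p] ord_eq_1[OF z(1)] prime_p by (auto simp: prime_nat_iff)
  qed
  have p0: "p \<noteq> 0" using prime_p by auto
  obtain y where y: "y \<in> A" "y \<noteq> \<one>"
  proof -
    \<comment> \<open>The first unit vector, which lies in the space because n is positive; its
      preimage is a nontrivial element of A.\<close>
    let ?u = "(\<lambda>i. if i = 0 then 1 else 0) :: nat \<Rightarrow> rat"
    have "?u \<in> rat_space n" using n by (auto simp: rat_space_def)
    then have "?u \<in> e ` A" using e(1) by (simp add: bij_betw_def)
    then obtain y where y: "y \<in> A" "e y = ?u" by auto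
    have "e y 0 \<noteq> e \<one> 0" unfolding y(2) e1 by simp
    then have "y \<noteq> \<one>" by auto
    with y(1) show thesis by (rule that)
  qed
  obtain x where x: "x \<in> H" "x \<noteq> \<one>"
  proof -
    have "H \<noteq> {\<one>}" using cardH prime_p by auto
    then show thesis using that H.one_closed by blast
  qed
  have xA: "x \<in> carrier G" "x \<notin> A" using x int by auto
  have mem: "z \<in> A" if "z \<in> carrier G" "ord z = 0" for z using ordp that p0 by metis
  have nmem: "z \<notin> A" if "z \<noteq> \<one>" "ord z \<noteq> 0" for z using tf that by metis
  have "\<exists>f\<in>auto G. f x = z" if "z \<in> carrier G" "z \<noteq> \<one>" "ord z \<noteq> 0" for z
  proof -
    have z: "z \<in> carrier G" "z \<notin> A" using nmem that by simp_all
    obtain f where "f \<in> auto G" "f x = z" using orbit_transitive[OF e xA z y y] .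
    then show ?thesis by (intro bexI[of _ f])
  qed
  moreover have "\<exists>f\<in>auto G. f y = z" if "z \<in> carrier G" "ord z = 0" for z
  proof -
    have z: "z \<in> A" "z \<noteq> \<one>" using mem ord_id that by auto
    obtain f where "f \<in> auto G" "f y = z" using orbit_transitive[OF e xA xA y z] .
    then show ?thesis by (intro bexI[of _ f])
  qed
  moreover have "ord x \<noteq> 0" using ordp[OF xA] p0 by simp
  ultimately show ?thesis
    using num_aut_orbits_eq_3[OF xA(1) x(2) _ A_carrier[OF y(1)] tf[OF y]] by simp
qed

end

section \<open>Torsion-free divisible groups of finite rank\<close>

context comm_group
begin

definition pow_prod :: "('i \<Rightarrow> 'a) \<Rightarrow> 'i set \<Rightarrow> ('i \<Rightarrow> int) \<Rightarrow> 'a" where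
  "pow_prod e I c = (\<Otimes>i\<in>I. e i [^] c i)"

lemma pow_prod_closed: "e \<in> I \<rightarrow> carrier G \<Longrightarrow> pow_prod e I c \<in> carrier G"
  unfolding pow_prod_def by (rule finprod_closed) auto

lemma pow_prod_mult:
  assumes "e \<in> I \<rightarrow> carrier G"
  shows "pow_prod e I c \<otimes> pow_prod e I d = pow_prod e I (\<lambda>i. c i + d i)"
proof -
  have "pow_prod e I (\<lambda>i. c i + d i) = (\<Otimes>i\<in>I. e i [^] c i \<otimes> e i [^] d i)"
    unfolding pow_prod_def using assms by (intro finprod_cong') (auto simp: int_pow_mult Pi_iff)
  also have "\<dots> = pow_prod e I c \<otimes> pow_prod e I d"
    unfolding pow_prod_def using assms by (intro finprod_multf) auto
  finally show ?thesis ..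
qed

lemma pow_prod_0: "(\<And>i. i \<in> I \<Longrightarrow> c i = 0) \<Longrightarrow> pow_prod e I c = \<one>"
  unfolding pow_prod_def by (rule finprod_one_eqI) simp

lemma pow_prod_cong:
  "\<lbrakk>e \<in> I \<rightarrow> carrier G; \<And>i. i \<in> I \<Longrightarrow> c i = d i\<rbrakk> \<Longrightarrow> pow_prod e I c = pow_prod e I d"
  unfolding pow_prod_def by (rule finprod_cong') auto

lemma pow_prod_insert:
  "\<lbrakk>e \<in> insert j I \<rightarrow> carrier G; finite I; j \<notin> I\<rbrakk> \<Longrightarrow> pow_prod e (insert j I) c = e j [^] c j \<otimes> pow_prod e I c"
  unfolding pow_prod_def by (rule finprod_insert) auto

lemma pow_prod_int_pow:
  assumes "finite I" "e \<in> I \<rightarrow> carrier G"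
  shows "pow_prod e I c [^] (k::int) = pow_prod e I (\<lambda>i. c i * k)"
  using assms
proof (induction I rule: finite_induct)
  case empty
  show ?case by (simp add: pow_prod_def)
next
  case (insert j I)
  have e: "e \<in> I \<rightarrow> carrier G" "e j \<in> carrier G" using insert.prems by auto
  have "pow_prod e (insert j I) c [^] k = (e j [^] c j \<otimes> pow_prod e I c) [^] k"
    using insert by (simp add: pow_prod_insert)
  also have "\<dots> = (e j [^] c j) [^] k \<otimes> pow_prod e I c [^] k"
    using e by (intro int_pow_distrib) (simp_all add: pow_prod_closed)
  also have "\<dots> = pow_prod e (insert j I) (\<lambda>i. c i * k)"
    using insert e by (simp add: pow_prod_insert int_pow_pow)
  finally show ?case .
qed

lemma pow_prod_single:
  assumes "finite I" "j \<in> I" "e \<in> I \<rightarrow> carrier G"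
  shows "pow_prod e I (\<lambda>i. if i = j then k else 0) = e j [^] k"
proof -
  have I: "insert j (I - {j}) = I" using assms by auto
  have "pow_prod e (insert j (I - {j})) (\<lambda>i. if i = j then k else 0) = e j [^] k \<otimes> \<one>"
    using assms pow_prod_0[of "I - {j}" "\<lambda>i. if i = j then k else 0" e]
    by (subst pow_prod_insert) auto
  moreover have "e j \<in> carrier G" using assms by auto
  ultimately show ?thesis unfolding I by simp
qed

lemma generate_eq_pow_prod:
  assumes T: "finite T" "T \<subseteq> carrier G"
  shows "generate G T = range (pow_prod (\<lambda>t. t) T)"
proof
  have e: "(\<lambda>t. t) \<in> T \<rightarrow> carrier G" using T by auto
  have "subgroup (range (pow_prod (\<lambda>t. t) T)) G"
  proof (rule subgroupI)
    show "range (pow_prod (\<lambda>t. t) T) \<subseteq> carrier G" using pow_prod_closed[OF e] by blast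
    fix x y assume "x \<in> range (pow_prod (\<lambda>t. t) T)" "y \<in> range (pow_prod (\<lambda>t. t) T)"
    then obtain c d where x: "x = pow_prod (\<lambda>t. t) T c" and y: "y = pow_prod (\<lambda>t. t) T d" by (elim rangeE)
    show "x \<otimes> y \<in> range (pow_prod (\<lambda>t. t) T)"
      unfolding x y pow_prod_mult[OF e] by (rule rangeI)
    have "inv x = x [^] (-1::int)" unfolding x using pow_prod_closed[OF e] by (simp add: int_pow_neg)
    then show "inv x \<in> range (pow_prod (\<lambda>t. t) T)"
      unfolding x pow_prod_int_pow[OF T(1) e] by simp
  qed auto
  moreover have "T \<subseteq> range (pow_prod (\<lambda>t. t) T)"
  proof
    fix t assume t: "t \<in> T"
    then have "pow_prod (\<lambda>t. t) T (\<lambda>i. if i = t then 1 else 0) = t"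
      using T pow_prod_single[OF T(1) t e, of 1] by auto
    then show "t \<in> range (pow_prod (\<lambda>t. t) T)" by (metis rangeI)
  qed
  ultimately show "generate G T \<subseteq> range (pow_prod (\<lambda>t. t) T)" by (intro generate_subgroup_incl)
  interpret S: subgroup "generate G T" G using generate_is_subgroup[OF T(2)] .
  show "range (pow_prod (\<lambda>t. t) T) \<subseteq> generate G T"
  proof (rule image_subsetI)
    fix c
    have "pow_prod (\<lambda>t. t) U c \<in> generate G T" if "finite U" "U \<subseteq> T" for U
      using that
    proof (induction U rule: finite_induct)
      case empty
      show ?case by (simp add: pow_prod_def)
    next
      case (insert u U)
      then have "u \<in> generate G T" "(\<lambda>t. t) \<in> insert u U \<rightarrow> carrier G"
        using generate.incl[of u T G] T by auto
      then show ?case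
        using insert subgroup_int_pow_closed[OF S.subgroup_axioms, of u "c u"] by (simp add: pow_prod_insert)
    qed
    then show "pow_prod (\<lambda>t. t) T c \<in> generate G T" using T by blast
  qed
qed

text \<open>Division of the exponents by q with remainder. It bounds the classes modulo q-th powers
  by q^|T|: in exponent q this bounds the group itself, and q = 2 is the case used for independent
  sets.\<close>

lemma generate_mod_powers:
  assumes T: "finite T" "T \<subseteq> carrier G" and x: "x \<in> generate G T" and q: "(q::int) > 0"
  obtains c z where "c \<in> T \<rightarrow>\<^sub>E {0..<q}" "z \<in> generate G T" "x = pow_prod (\<lambda>t. t) T c \<otimes> z [^] q"
proof -
  have e: "(\<lambda>t. t) \<in> T \<rightarrow> carrier G" using T by auto
  obtain d where d: "x = pow_prod (\<lambda>t. t) T d" using x unfolding generate_eq_pow_prod[OF T] by (elim rangeE)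
  let ?c = "\<lambda>t\<in>T. d t mod q" and ?z = "pow_prod (\<lambda>t. t) T (\<lambda>t. d t div q)"
  have "x = pow_prod (\<lambda>t. t) T (\<lambda>t. ?c t + d t div q * q)"
    unfolding d by (rule pow_prod_cong[OF e]) simp
  also have "\<dots> = pow_prod (\<lambda>t. t) T ?c \<otimes> ?z [^] q"
    unfolding pow_prod_int_pow[OF T(1) e] pow_prod_mult[OF e] ..
  finally show thesis
    using that[of ?c ?z] q unfolding generate_eq_pow_prod[OF T] by simp
qed

lemma card_generate_exponent:
  assumes T: "finite T" "T \<subseteq> carrier G" and q: "(q::nat) > 0"
    and exp: "\<And>x. x \<in> carrier G \<Longrightarrow> x [^] q = \<one>"
  shows "finite (generate G T)" "card (generate G T) \<le> q ^ card T"
proof -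
  let ?F = "T \<rightarrow>\<^sub>E {0..<int q}"
  have fin: "finite ?F" using T by (intro finite_PiE) auto
  have sub: "generate G T \<subseteq> pow_prod (\<lambda>t. t) T ` ?F"
  proof
    fix x assume x: "x \<in> generate G T"
    obtain c z where c: "c \<in> ?F" "z \<in> generate G T" "x = pow_prod (\<lambda>t. t) T c \<otimes> z [^] int q"
      using generate_mod_powers[OF T x, of "int q"] q by auto
    have "z [^] int q = \<one>" using exp[of z] generate_in_carrier[OF T(2) c(2)] by (simp add: int_pow_int)
    moreover have "pow_prod (\<lambda>t. t) T c \<in> carrier G" using T by (intro pow_prod_closed) auto
    ultimately have "x = pow_prod (\<lambda>t. t) T c" using c(3) by simp
    then show "x \<in> pow_prod (\<lambda>t. t) T ` ?F" using c(1) by (rule image_eqI)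
  qed
  show "finite (generate G T)" by (rule finite_subset[OF sub]) (use fin in simp)
  have "card (generate G T) \<le> card ?F"
    using card_mono[OF _ sub] card_image_le[OF fin, of "pow_prod (\<lambda>t. t) T"] fin by fastforce
  also have "\<dots> = q ^ card T" using T by (simp add: card_PiE)
  finally show "card (generate G T) \<le> q ^ card T" .
qed

definition indep :: "'a set \<Rightarrow> bool" where
  "indep E \<longleftrightarrow> finite E \<and> E \<subseteq> carrier G \<and> (\<forall>c. pow_prod (\<lambda>t. t) E c = \<one> \<longrightarrow> (\<forall>x\<in>E. c x = 0))"

text \<open>Modulo squares the \<open>2\<^bsup>|E|\<^esup>\<close> subset products of \<open>E\<close> are distinct, while \<open>T\<close> generates at most \<open>2\<^bsup>|T|\<^esup>\<close> classes.\<close>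

lemma indep_card_le:
  assumes E: "indep E" and T: "finite T" "T \<subseteq> carrier G" "generate G T = generate G E"
  shows "card E \<le> card T"
proof -
  have E': "finite E" "E \<subseteq> carrier G" using E by (auto simp: indep_def)
  have e: "(\<lambda>t. t) \<in> E \<rightarrow> carrier G" using E' by auto
  let ?F = "T \<rightarrow>\<^sub>E {0..<2::int}"
  let ?\<chi> = "\<lambda>S x. if x \<in> S then 1 else 0 :: int"
  have "\<exists>c d. c \<in> ?F \<and> pow_prod (\<lambda>t. t) E (?\<chi> S) = pow_prod (\<lambda>t. t) T c \<otimes> pow_prod (\<lambda>t. t) E d [^] (2::int)" for S
  proof -
    have "pow_prod (\<lambda>t. t) E (?\<chi> S) \<in> generate G T" unfolding T generate_eq_pow_prod[OF E'] by (rule rangeI)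
    then obtain c z where c: "c \<in> ?F" "z \<in> generate G T" "pow_prod (\<lambda>t. t) E (?\<chi> S) = pow_prod (\<lambda>t. t) T c \<otimes> z [^] (2::int)"
      using generate_mod_powers[OF T(1,2)] by (metis zero_less_numeral)
    moreover obtain d where "z = pow_prod (\<lambda>t. t) E d"
      using c(2) unfolding T generate_eq_pow_prod[OF E'] by (elim rangeE)
    ultimately show ?thesis by blast
  qed
  then obtain c d where cF: "\<And>S. c S \<in> ?F"
    and cd: "\<And>S. pow_prod (\<lambda>t. t) E (?\<chi> S) = pow_prod (\<lambda>t. t) T (c S) \<otimes> pow_prod (\<lambda>t. t) E (d S) [^] (2::int)"
    by metis
  have Tc: "pow_prod (\<lambda>t. t) T (c S) \<in> carrier G" for S using T by (intro pow_prod_closed) auto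
  have key: "pow_prod (\<lambda>t. t) T (c S) = pow_prod (\<lambda>t. t) E (\<lambda>x. ?\<chi> S x - d S x * 2)" for S
  proof -
    have "pow_prod (\<lambda>t. t) E (\<lambda>x. ?\<chi> S x - d S x * 2) \<otimes> pow_prod (\<lambda>t. t) E (d S) [^] (2::int)
       = pow_prod (\<lambda>t. t) E (?\<chi> S)"
      unfolding pow_prod_int_pow[OF E'(1) e] pow_prod_mult[OF e] by simp
    also note cd
    finally show ?thesis using Tc pow_prod_closed[OF e] by simp
  qed
  \<comment> \<open>If S and S' receive the same class, dividing the two products gives a relation
    on E whose coefficients are the differences of the indicators up to even numbers. Independence
    makes them 0, so S and S' agree by parity.\<close>
  have "inj_on c (Pow E)"
  proof (rule inj_onI)
    fix S S' assume S: "S \<in> Pow E" "S' \<in> Pow E" "c S = c S'"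
    have "pow_prod (\<lambda>t. t) E (\<lambda>x. (?\<chi> S x - d S x * 2) + (?\<chi> S' x - d S' x * 2) * (-1))
       = pow_prod (\<lambda>t. t) T (c S) \<otimes> pow_prod (\<lambda>t. t) T (c S') [^] (-1::int)"
      unfolding key pow_prod_int_pow[OF E'(1) e] pow_prod_mult[OF e] ..
    also have "\<dots> = \<one>" unfolding S(3) using Tc by (simp add: int_pow_neg)
    finally have *: "(?\<chi> S x - d S x * 2) + (?\<chi> S' x - d S' x * 2) * (-1) = 0" if "x \<in> E" for x
      using E that unfolding indep_def by blast
    have "x \<in> S \<longleftrightarrow> x \<in> S'" if "x \<in> E" for x
      using *[OF that] by (cases "x \<in> S"; cases "x \<in> S'") (simp; presburger)+
    then show "S = S'" using S(1,2) by blast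
  qed
  then have "card (Pow E) \<le> card ?F"
    using cF T by (intro card_inj_on_le[of c]) (auto intro!: finite_PiE)
  then have "(2::nat) ^ card E \<le> 2 ^ card T" using E' T by (simp add: card_Pow card_PiE)
  then show ?thesis by simp
qed


text \<open>The rank bounds independent sets, so a maximal one E exists, and every a has a power
  a^m, m nonzero, in the span of E. The exponents divided by m are its rational coordinates;
  injectivity uses torsion-freeness and surjectivity divisibility.\<close>

lemma torsion_free_divisible_iso:
  assumes tf: "\<And>x k. \<lbrakk>x \<in> carrier G; k \<noteq> 0; x [^] (k::int) = \<one>\<rbrakk> \<Longrightarrow> x = \<one>"
    and div: "\<And>x k. \<lbrakk>x \<in> carrier G; k \<noteq> 0\<rbrakk> \<Longrightarrow> \<exists>y\<in>carrier G. y [^] (k::int) = x"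
    and rank: "\<And>S. \<lbrakk>finite S; S \<subseteq> carrier G\<rbrakk> \<Longrightarrow>
      \<exists>T\<subseteq>carrier G. finite T \<and> card T \<le> r \<and> generate G T = generate G S"
    and nontrivial: "carrier G \<noteq> {\<one>}"
  obtains n where "n > 0" "G \<cong> rational_power_group n"
proof -
  have "indep {}" by (simp add: indep_def)
  moreover have "card E < Suc r" if E: "indep E" for E
  proof -
    obtain T where "T \<subseteq> carrier G" "finite T" "card T \<le> r" "generate G T = generate G E"
      using rank[of E] E unfolding indep_def by blast
    then show ?thesis using indep_card_le[OF E] by fastforce
  qed
  ultimately obtain E where E: "indep E" and max: "\<And>E'. indep E' \<Longrightarrow> card E' \<le> card E"
    using ex_has_greatest_nat[of indep "{}" card "Suc r"] by blast
  have E': "finite E" "E \<subseteq> carrier G" "\<And>c x. \<lbrakk>pow_prod (\<lambda>t. t) E c = \<one>; x \<in> E\<rbrakk> \<Longrightarrow> c x = 0"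
    using E by (auto simp: indep_def)
  have e: "(\<lambda>t. t) \<in> E \<rightarrow> carrier G" using E' by auto
  let ?P = "pow_prod (\<lambda>t. t) E"
  have "\<exists>m c. m \<noteq> 0 \<and> a [^] (m::int) = ?P c" if a: "a \<in> carrier G" for a
  proof (cases "a \<in> E")
    case True
    have "a [^] (1::int) = ?P (\<lambda>i. if i = a then 1 else 0)"
      by (rule pow_prod_single[OF E'(1) True e, symmetric])
    then show ?thesis by (intro exI[of _ "1::int"]) auto
  next
    case False
    \<comment> \<open>By maximality a satisfies a relation with E, and its exponent in it is nonzero
      because E alone is independent.\<close>
    have "\<not> indep (insert a E)" using max[of "insert a E"] False E'(1) by auto
    then obtain c x where c: "pow_prod (\<lambda>t. t) (insert a E) c = \<one>" and x: "x \<in> insert a E" "c x \<noteq> 0"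
      using E' a unfolding indep_def by auto
    have "a [^] c a \<otimes> ?P c = \<one>" 
      using c pow_prod_insert[of "\<lambda>t. t" a E c] e E'(1) a False by simp
    moreover have "?P c \<otimes> ?P (\<lambda>x. - c x) = \<one>"
      unfolding pow_prod_mult[OF e] by (rule pow_prod_0) simp
    ultimately have eq: "a [^] c a = ?P (\<lambda>x. - c x)"
      using a pow_prod_closed[OF e] by (metis int_pow_closed inv_equality m_comm)
    have "c a \<noteq> 0"
    proof
      assume 0: "c a = 0"
      then have "?P (\<lambda>x. - c x) = \<one>" using eq by simp
      then have "c x = 0" if "x \<in> E" for x using E'(3)[of "\<lambda>x. - c x" x] that by simp
      then show False using x 0 by auto
    qed
    then show ?thesis using eq by blast
  qed
  then obtain m c where m: "\<And>a. a \<in> carrier G \<Longrightarrow> m a \<noteq> 0"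
    and c: "\<And>a. a \<in> carrier G \<Longrightarrow> a [^] (m a :: int) = ?P (c a)"
    by metis
  obtain n where n: "card E = n" by simp
  obtain h where h: "bij_betw h {..<n} E"
    using ex_bij_betw_nat_finite[OF E'(1)] n by (auto simp: atLeast0LessThan)
  define \<phi> where "\<phi> a = (\<lambda>i\<in>{..<n}. of_int (c a (h i)) / of_int (m a) :: rat)" for a
  have hE: "h i \<in> E" if "i < n" for i using h that by (auto simp: bij_betw_def)
  \<comment> \<open>The coordinates do not depend on the chosen power of a; any other one may be
    used to compute them.\<close>
  have \<phi>: "\<phi> a i = of_int (d (h i)) / of_int k"
    if a: "a \<in> carrier G" and k: "k \<noteq> 0" "a [^] (k::int) = ?P d" and i: "i < n" for a k d i
  proof -
    have "?P (\<lambda>x. d x * m a) = (a [^] k) [^] m a"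
      unfolding k by (simp add: pow_prod_int_pow[OF E'(1) e])
    also have "\<dots> = (a [^] m a) [^] k" using a by (simp add: int_pow_pow mult.commute)
    also have "\<dots> = ?P (\<lambda>x. c a x * k)" unfolding c[OF a] by (rule pow_prod_int_pow[OF E'(1) e])
    finally have "?P (\<lambda>x. d x * m a) = ?P (\<lambda>x. c a x * k)" .
    moreover have "?P (\<lambda>x. c a x * k) \<otimes> ?P (\<lambda>x. - (c a x * k)) = \<one>"
      unfolding pow_prod_mult[OF e] by (rule pow_prod_0) simp
    ultimately have "?P (\<lambda>x. d x * m a + - (c a x * k)) = \<one>"
      unfolding pow_prod_mult[OF e, symmetric] by simp
    from E'(3)[OF this hE[OF i]] have "d (h i) * m a = c a (h i) * k" by simp
    then have "of_int (d (h i)) * of_int (m a) = (of_int (c a (h i)) * of_int k :: rat)"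
      by (metis of_int_mult)
    then show ?thesis using m[OF a] k i by (simp add: \<phi>_def field_simps)
  qed
  have mult: "\<phi> (a \<otimes> b) = (\<lambda>i\<in>{..<n}. \<phi> a i + \<phi> b i)" if a: "a \<in> carrier G" and b: "b \<in> carrier G" for a b
  proof
    fix i
    have "(a \<otimes> b) [^] (m a * m b) = (a [^] m a) [^] m b \<otimes> (b [^] m b) [^] m a"
      using a b by (simp add: int_pow_distrib int_pow_pow mult.commute)
    also have "\<dots> = ?P (\<lambda>x. c a x * m b + c b x * m a)"
      unfolding c[OF a] c[OF b] pow_prod_int_pow[OF E'(1) e] pow_prod_mult[OF e] ..
    finally have pow: "(a \<otimes> b) [^] (m a * m b) = ?P (\<lambda>x. c a x * m b + c b x * m a)" .
    have "\<phi> (a \<otimes> b) i = of_int (c a (h i) * m b + c b (h i) * m a) / of_int (m a * m b)" if "i < n"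
      by (rule \<phi>[OF _ _ pow that]) (use m[OF a] m[OF b] a b in simp_all)
    then show "\<phi> (a \<otimes> b) i = (\<lambda>i\<in>{..<n}. \<phi> a i + \<phi> b i) i"
      using m[OF a] m[OF b] by (cases "i < n") (simp_all add: \<phi>_def field_simps)
  qed
  have inj: "inj_on \<phi> (carrier G)"
  proof (rule inj_onI)
    fix a b assume a: "a \<in> carrier G" and b: "b \<in> carrier G" and eq: "\<phi> a = \<phi> b"
    have "c a x * m b = c b x * m a" if "x \<in> E" for x
    proof -
      obtain i where i: "i < n" "x = h i" using h \<open>x \<in> E\<close> by (auto simp: bij_betw_def)
      have "\<phi> a i = \<phi> b i" using eq by simp
      then have "of_int (c a x) / of_int (m a) = (of_int (c b x) / of_int (m b) :: rat)"
        using i by (simp add: \<phi>_def)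
      then have "of_int (c a x * m b) = (of_int (c b x * m a) :: rat)"
        using m[OF a] m[OF b] by (simp add: field_simps)
      then show ?thesis by (simp only: of_int_eq_iff)
    qed
    then have "?P (\<lambda>x. c a x * m b) = ?P (\<lambda>x. c b x * m a)" by (rule pow_prod_cong[OF e])
    then have "(a [^] m a) [^] m b = (b [^] m b) [^] m a"
      unfolding c[OF a] c[OF b] pow_prod_int_pow[OF E'(1) e] .
    then have "(a \<otimes> inv b) [^] (m a * m b) = \<one>"
      using a b by (simp add: int_pow_distrib int_pow_pow int_pow_inv mult.commute)
    moreover have "m a * m b \<noteq> 0" using m a b by simp
    ultimately have "a \<otimes> inv b = \<one>" using tf[of "a \<otimes> inv b" "m a * m b"] a b by simp
    then show "a = b" using a b by (simp add: inv_solve_right')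
  qed
  have surj: "\<phi> ` carrier G = ({..<n} \<rightarrow>\<^sub>E UNIV)"
  proof (intro equalityI subsetI)
    fix f :: "nat \<Rightarrow> rat" assume f: "f \<in> {..<n} \<rightarrow>\<^sub>E UNIV"
    \<comment> \<open>A common denominator of all coordinates: k f is integral, and a k-th root of
      the corresponding product has coordinates f.\<close>
    define k where "k = (\<Prod>i<n. snd (quotient_of (f i)))"
    have k: "k \<noteq> 0" unfolding k_def using quotient_of_denom_pos' by (auto simp: less_imp_neq[symmetric])
    have "\<exists>d. of_int d = of_int k * f i" if i: "i < n" for i
    proof -
      have fi: "f i = of_int (fst (quotient_of (f i))) / of_int (snd (quotient_of (f i)))"
        by (rule quotient_of_div) simp
      have pos: "snd (quotient_of (f i)) > 0" by (rule quotient_of_denom_pos')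
      have "snd (quotient_of (f i)) dvd k" unfolding k_def using i by (intro dvd_prodI) auto
      then obtain l where l: "k = snd (quotient_of (f i)) * l" by (elim dvdE)
      have "of_int k * f i = of_int (l * fst (quotient_of (f i)))"
        unfolding l by (subst fi) (use pos in simp)
      then show ?thesis by metis
    qed
    then obtain d where d: "\<And>i. i < n \<Longrightarrow> of_int (d i) = of_int k * f i" by metis
    define d' where "d' x = d (inv_into {..<n} h x)" for x
    have d': "d' (h i) = d i" if "i < n" for i
      using h that by (simp add: d'_def bij_betw_def)
    obtain a where a: "a \<in> carrier G" "a [^] k = ?P d'"
      using div[OF pow_prod_closed[OF e] k] by blast
    have "\<phi> a = f"
    proof
      fix i show "\<phi> a i = f i"
      proof (cases "i < n")
        case True
        then show ?thesis using \<phi>[OF a(1) k a(2) True] d[OF True] d'[OF True] k by simp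
      next
        case False
        then show ?thesis using PiE_arb[OF f, of i] by (simp add: \<phi>_def)
      qed
    qed
    then show "f \<in> \<phi> ` carrier G" using a(1) by (rule image_eqI[OF sym])
  next
    fix f assume "f \<in> \<phi> ` carrier G"
    then obtain a where "f = \<phi> a" by (elim imageE)
    then show "f \<in> {..<n} \<rightarrow>\<^sub>E UNIV" by (simp add: \<phi>_def)
  qed
  have "\<phi> \<in> iso G (rational_power_group n)"
  proof (rule isoI)
    show "\<phi> \<in> hom G (rational_power_group n)"
    proof (rule homI)
      show "\<phi> a \<in> carrier (rational_power_group n)" if "a \<in> carrier G" for a
        unfolding carrier_rational_power_group surj[symmetric] using that by (rule imageI)
      show "\<phi> (a \<otimes> b) = \<phi> a \<otimes>\<^bsub>rational_power_group n\<^esub> \<phi> b" if "a \<in> carrier G" "b \<in> carrier G" for a b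
        unfolding mult_rational_power_group by (rule mult[OF that])
    qed
    show "bij_betw \<phi> (carrier G) (carrier (rational_power_group n))"
      unfolding bij_betw_def carrier_rational_power_group using inj surj by simp
  qed
  then have iso: "G \<cong> rational_power_group n" by (auto simp: is_iso_def)
  have "n > 0"
  proof (rule ccontr)
    assume "\<not> n > 0"
    \<comment> \<open>With E empty, a nonzero power of every element is trivial.\<close>
    then have "E = {}" using n E' by simp
    then have "a = \<one>" if "a \<in> carrier G" for a
      using tf[OF that m[OF that]] c[OF that] by (simp add: pow_prod_def)
    then show False using nontrivial by blast
  qed
  then show thesis using iso by (rule that)
qed

end

section \<open>Groups with three automorphism orbits\<close>

locale three_orbits = group G for G :: "('a, 'b) monoid_scheme" (structure) +
  assumes soluble: "solvable G"
    and ex_torsion: "\<exists>x\<in>carrier G. x \<noteq> \<one> \<and> ord x \<noteq> 0"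
    and ex_free: "\<exists>y\<in>carrier G. ord y = 0"
    and torsion_trans: "\<lbrakk>x \<in> carrier G; x \<noteq> \<one>; ord x \<noteq> 0; z \<in> carrier G; z \<noteq> \<one>; ord z \<noteq> 0\<rbrakk>
      \<Longrightarrow> \<exists>f\<in>auto G. f x = z"
    and free_trans: "\<lbrakk>y \<in> carrier G; ord y = 0; z \<in> carrier G; ord z = 0\<rbrakk> \<Longrightarrow> \<exists>f\<in>auto G. f y = z"
begin

definition torsion :: "'a set" where
  "torsion = {x \<in> carrier G. x \<noteq> \<one> \<and> ord x \<noteq> 0}"

definition free :: "'a set" where
  "free = {x \<in> carrier G. ord x = 0}"

lemma free_ne_one: "y \<in> free \<Longrightarrow> y \<noteq> \<one>"
  by (auto simp: free_def)

lemma carrier_eq: "carrier G = insert \<one> (torsion \<union> free)"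
  by (auto simp: torsion_def free_def)

lemma torsion_conj: "\<lbrakk>x \<in> torsion; z \<in> torsion\<rbrakk> \<Longrightarrow> \<exists>f\<in>auto G. f x = z"
  unfolding torsion_def by (simp add: torsion_trans)

lemma free_conj: "\<lbrakk>x \<in> free; z \<in> free\<rbrakk> \<Longrightarrow> \<exists>f\<in>auto G. f x = z"
  unfolding free_def by (simp add: free_trans)

text \<open>The power y^k also has infinite order, and an automorphism taking y^k to y takes y to a
  k-th root of y.\<close>

lemma free_root:
  assumes y: "y \<in> free" and k: "(k::nat) > 0"
  obtains z where "z \<in> free" "z [^] k = y"
proof -
  have yc: "y \<in> carrier G" "ord y = 0" using y by (auto simp: free_def)
  have "ord (y [^] k) = 0"
    using pow_eq_id[OF yc(1), of "k * ord (y [^] k)"] pow_ord_eq_1[of "y [^] k"] nat_pow_pow[OF yc(1)] yc k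
    by simp
  then have "y [^] k \<in> free" using yc by (simp add: free_def)
  then obtain f where f: "f \<in> auto G" "f (y [^] k) = y"
    using free_conj y by blast
  have "f y [^] k = y" using auto_nat_pow[OF f(1) yc(1), of k] f(2) by simp
  moreover have "f y \<in> free" using auto_closed[OF f(1)] auto_ord[OF f(1)] yc by (simp add: free_def)
  ultimately show thesis using that by blast
qed

text \<open>A suitable power of a torsion element has prime order, and all torsion elements share
  one order since they form one orbit.\<close>

lemma torsion_prime_order:
  "\<exists>p. Factorial_Ring.prime p \<and> (\<forall>x\<in>torsion. ord x = p)"
proof -
  obtain x where x: "x \<in> carrier G" "x \<noteq> \<one>" "ord x \<noteq> 0" using ex_torsion by blast
  have same: "ord z = ord w" if z: "z \<in> torsion" and w: "w \<in> torsion" for z w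
  proof -
    obtain f where "f \<in> auto G" "f w = z" using torsion_conj z w by blast
    then show ?thesis using auto_ord[of f w] w by (simp add: torsion_def)
  qed
  have "ord x \<noteq> 1" using ord_eq_1[OF x(1)] x(2) by simp
  then obtain q where q: "Factorial_Ring.prime q" "q dvd ord x" using prime_factor_nat by blast
  then obtain k where k: "ord x = q * k" by (elim dvdE)
  have "k \<noteq> 0" using k x(3) by auto
  then have "ord (x [^] k) = q" using ord_pow[OF x(1), of k] k by simp
  moreover have "q \<noteq> 1" "q \<noteq> 0" using q(1) by auto
  ultimately have "x [^] k \<in> torsion" using x(1) ord_eq_1[of "x [^] k"] by (auto simp: torsion_def)
  then have "ord z = q" if "z \<in> torsion" for z using same[OF that] \<open>ord (x [^] k) = q\<close> by simp
  then show ?thesis using q(1) by blast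
qed

definition characteristic :: "'a set \<Rightarrow> bool" where
  "characteristic K \<longleftrightarrow> subgroup K G \<and> (\<forall>f\<in>auto G. f ` K \<subseteq> K)"

text \<open>K is a union of orbits containing the identity.\<close>

lemma characteristic_cases:
  assumes K: "characteristic K"
  shows "K = {\<one>} \<or> K = insert \<one> torsion \<or> K = insert \<one> free \<or> K = carrier G"
proof -
  interpret K: subgroup K G using K by (simp add: characteristic_def)
  have inv: "f x \<in> K" if "f \<in> auto G" "x \<in> K" for f x
    using K that unfolding characteristic_def by (meson image_subset_iff)
  have tors: "torsion \<subseteq> K" if x: "x \<in> K" "x \<in> torsion" for x
  proof
    fix z assume z: "z \<in> torsion"
    obtain f where "f \<in> auto G" "f x = z" using torsion_conj[OF x(2) z] by (elim bexE)
    then show "z \<in> K" using inv[of f x] x(1) by simp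
  qed
  have fr: "free \<subseteq> K" if x: "x \<in> K" "x \<in> free" for x
  proof
    fix z assume z: "z \<in> free"
    obtain f where "f \<in> auto G" "f x = z" using free_conj[OF x(2) z] by (elim bexE)
    then show "z \<in> K" using inv[of f x] x(1) by simp
  qed
  have sub: "K \<subseteq> insert \<one> (torsion \<union> free)" using K.subset carrier_eq by simp
  have one: "\<one> \<in> K" by simp
  consider "torsion \<inter> K = {}" "free \<inter> K = {}" | "torsion \<inter> K = {}" "free \<subseteq> K"
    | "torsion \<subseteq> K" "free \<inter> K = {}" | "torsion \<subseteq> K" "free \<subseteq> K"
    using tors fr by (metis disjoint_iff)
  then show ?thesis
  proof cases
    case 1
    have "K = {\<one>}" by (rule equalityI) (use 1 sub one in blast)+
    then show ?thesis by simp
  next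
    case 2
    have "K = insert \<one> free" by (rule equalityI) (use 2 sub one in blast)+
    then show ?thesis by simp
  next
    case 3
    have "K = insert \<one> torsion" by (rule equalityI) (use 3 sub one in blast)+
    then show ?thesis by simp
  next
    case 4
    have "K = carrier G" unfolding carrier_eq by (rule equalityI) (use 4 sub one in blast)+
    then show ?thesis by simp
  qed
qed

lemma characteristic_carrier: "characteristic (carrier G)"
  using auto_closed by (auto simp: characteristic_def subgroup_self)

lemma characteristic_derived:
  assumes K: "characteristic K"
  shows "characteristic (derived G K)"
proof -
  have sub: "K \<subseteq> carrier G" using K by (simp add: characteristic_def subgroup.subset)
  have "f ` derived G K \<subseteq> derived G K" if f: "f \<in> auto G" for f
    using group_hom.derived_img[OF autoD(3)[OF f] sub] mono_derived[of "f ` K" K] K f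
    by (simp add: characteristic_def)
  then show ?thesis using derived_is_subgroup[OF sub] by (simp add: characteristic_def)
qed

text \<open>Otherwise the derived series of G would never drop below K.\<close>

lemma derived_ne_self:
  assumes K: "subgroup K G" "K \<noteq> {\<one>}"
  shows "derived G K \<noteq> K"
proof
  assume eq: "derived G K = K"
  obtain n where n: "(derived G ^^ n) (carrier G) = {\<one>}" using soluble solvable_iff_trivial_derived_seq by blast
  have "(derived G ^^ n) K = K" by (induction n) (simp_all add: eq)
  then have "K \<subseteq> {\<one>}" using mono_exp_of_derived[OF subgroup.subset[OF K(1)], of n] n by simp
  then show False using K subgroup.one_closed[OF K(1)] by blast
qed

lemma commute_if_derived_trivial:
  assumes K: "K \<subseteq> carrier G" "derived G K = {\<one>}" and x: "x \<in> K" "y \<in> K"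
  shows "x \<otimes> y = y \<otimes> x"
proof -
  have "x \<otimes> y \<otimes> inv x \<otimes> inv y \<in> derived G K"
    unfolding derived_def using x by (intro generate.incl) blast
  then have "x \<otimes> y \<otimes> inv x \<otimes> inv y = \<one>" using K(2) by simp
  moreover have "x \<in> carrier G" "y \<in> carrier G" using K(1) x by auto
  ultimately show ?thesis by (metis inv_closed inv_equality inv_inv inv_solve_right' m_closed)
qed

text \<open>In an abelian G take x torsion, y free and roots z^p = x y, w^p = y. Then z / w has p-th
  power x, so it is torsion and has order p, which forces x = 1.\<close>

lemma not_commutative: "\<not> (\<forall>x\<in>carrier G. \<forall>y\<in>carrier G. x \<otimes> y = y \<otimes> x)"
proof
  assume comm: "\<forall>x\<in>carrier G. \<forall>y\<in>carrier G. x \<otimes> y = y \<otimes> x"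
  then have comm': "x \<otimes> y = y \<otimes> x" if "x \<in> carrier G" "y \<in> carrier G" for x y using that by blast
  obtain p where p: "Factorial_Ring.prime p" "\<And>x. x \<in> torsion \<Longrightarrow> ord x = p" using torsion_prime_order by blast
  obtain x where x: "x \<in> torsion" using ex_torsion by (auto simp: torsion_def)
  obtain y where y: "y \<in> free" using ex_free by (auto simp: free_def)
  have c: "x \<in> carrier G" "y \<in> carrier G" using x y by (auto simp: torsion_def free_def)
  have p0: "p > 0" using p(1) by (simp add: prime_gt_0_nat)
  have xp: "x [^] p = \<one>" using pow_ord_eq_1[OF c(1)] p(2)[OF x] by simp
  have "x \<otimes> y \<in> free"
  proof -
    have "n = 0" if n: "(x \<otimes> y) [^] n = \<one>" for n :: nat
    proof -
      have "(x \<otimes> y) [^] (n * p) = \<one>" using n c by (simp flip: nat_pow_pow)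
      then have "x [^] (p * n) \<otimes> y [^] (n * p) = \<one>"
        using pow_mult_distrib[OF comm'[OF c] c, of "n * p"] by (simp add: mult.commute)
      then have "y [^] (n * p) = \<one>" using xp c by (simp flip: nat_pow_pow)
      then show ?thesis using pow_eq_id[OF c(2), of "n * p"] y p0 by (simp add: free_def)
    qed
    then show ?thesis using pow_ord_eq_1[of "x \<otimes> y"] c by (simp add: free_def)
  qed
  then obtain z where z: "z \<in> free" "z [^] p = x \<otimes> y" using free_root p0 by blast
  obtain w where w: "w \<in> free" "w [^] p = y" using free_root[OF y] p0 by blast
  have zw: "z \<in> carrier G" "w \<in> carrier G" using z w by (auto simp: free_def)
  have "(z \<otimes> inv w) [^] p = z [^] p \<otimes> inv (w [^] p)"
    using pow_mult_distrib[OF comm', of z "inv w" p] zw by (simp add: nat_pow_inv)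
  also have "\<dots> = x" unfolding z(2) w(2) using c by (simp add: m_assoc)
  finally have zwp: "(z \<otimes> inv w) [^] p = x" .
  then have "(z \<otimes> inv w) [^] (p * p) = \<one>" using xp zw by (simp flip: nat_pow_pow)
  then have "ord (z \<otimes> inv w) dvd p * p" using pow_eq_id[of "z \<otimes> inv w" "p * p"] zw by simp
  then have "ord (z \<otimes> inv w) \<noteq> 0" using p0 by (intro notI) simp
  moreover have "z \<otimes> inv w \<noteq> \<one>" using zwp x by (auto simp: torsion_def)
  ultimately have "z \<otimes> inv w \<in> torsion" using zw by (simp add: torsion_def)
  then have "(z \<otimes> inv w) [^] p = \<one>" using pow_ord_eq_1[of "z \<otimes> inv w"] p(2) zw by simp
  then show False using zwp x by (simp add: torsion_def)
qed

text \<open>The derived subgroup is proper by solubility and nontrivial because G is not abelian,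
  which leaves two candidates. Its own derived subgroup is strictly smaller; as neither candidate
  contains the other, it is trivial.\<close>

lemma derived_cases:
  "derived G (carrier G) = insert \<one> torsion \<or> derived G (carrier G) = insert \<one> free"
  "x \<in> derived G (carrier G) \<Longrightarrow> y \<in> derived G (carrier G) \<Longrightarrow> x \<otimes> y = y \<otimes> x"
proof -
  let ?D = "derived G (carrier G)"
  obtain t where t: "t \<in> torsion" using ex_torsion by (auto simp: torsion_def)
  obtain y0 where y0: "y0 \<in> free" using ex_free by (auto simp: free_def)
  have t1: "t \<noteq> \<one>" "t \<in> carrier G" "t \<notin> free" using t by (auto simp: torsion_def free_def)
  have y1: "y0 \<noteq> \<one>" "y0 \<in> carrier G" "y0 \<notin> torsion" using y0 free_ne_one by (auto simp: torsion_def free_def)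
  have D: "characteristic ?D" by (intro characteristic_derived characteristic_carrier)
  have subD: "subgroup ?D G" using D by (simp add: characteristic_def)
  have "?D \<noteq> carrier G" using derived_ne_self[OF subgroup_self] t1 by blast
  moreover have "?D \<noteq> {\<one>}"
    using not_commutative commute_if_derived_trivial[of "carrier G"] by blast
  ultimately show cases: "?D = insert \<one> torsion \<or> ?D = insert \<one> free"
    using characteristic_cases[OF D] by blast
  then have D1: "?D \<noteq> {\<one>}" using t t1 y0 y1 by blast
  have "derived G ?D = {\<one>}"
  proof -
    have sub: "derived G ?D \<subseteq> ?D" by (rule derived_incl[OF subset_refl subD])
    have "derived G ?D \<noteq> ?D" using derived_ne_self[OF subD D1] .
    then show ?thesis
      using characteristic_cases[OF characteristic_derived[OF D]] cases sub t t1 y0 y1 by blast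
  qed
  then show "x \<otimes> y = y \<otimes> x" if "x \<in> ?D" "y \<in> ?D"
    using commute_if_derived_trivial[OF subgroup.subset[OF subD]] that by blast
qed


lemma conjugate_nat_pow:
  "\<lbrakk>x \<in> carrier G; z \<in> carrier G\<rbrakk> \<Longrightarrow> conjugate x (z [^] (k::nat)) = conjugate x z [^] k"
  by (induction k) (simp_all add: conjugate_mult)

lemma subgroup_comm_group:
  assumes "subgroup K G" "\<And>x y. \<lbrakk>x \<in> K; y \<in> K\<rbrakk> \<Longrightarrow> x \<otimes> y = y \<otimes> x"
  shows "comm_group (G\<lparr>carrier := K\<rparr>)"
  using assms by (intro group.group_comm_groupI subgroup_imp_group) auto

lemma derived_ne_torsion:
  assumes rank: "\<And>S. \<lbrakk>finite S; S \<subseteq> carrier G\<rbrakk> \<Longrightarrow>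
      \<exists>T\<subseteq>carrier G. finite T \<and> card T \<le> r \<and> generate G T = generate G S"
  shows "derived G (carrier G) \<noteq> insert \<one> torsion"
proof
  define P where "P = derived G (carrier G)"
  assume "derived G (carrier G) = insert \<one> torsion"
  then have P: "P = insert \<one> torsion" by (simp add: P_def)
  have subP: "subgroup P G" unfolding P_def by (rule derived_is_subgroup) simp
  have Pc: "x \<in> carrier G" if "x \<in> P" for x using subgroup.mem_carrier[OF subP that] .
  have comm: "x \<otimes> y = y \<otimes> x" if "x \<in> P" "y \<in> P" for x y
    using derived_cases(2) that unfolding P_def by blast
  obtain p where p: "Factorial_Ring.prime p" "\<And>x. x \<in> torsion \<Longrightarrow> ord x = p" using torsion_prime_order by blast
  have p0: "p > 0" using p(1) by (simp add: prime_gt_0_nat)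
  have exp: "x [^] p = \<one>" if "x \<in> P" for x
    using that P p(2)[of x] pow_ord_eq_1[OF Pc[OF that]] by auto
  interpret K: comm_group "G\<lparr>carrier := P\<rparr>" using subP comm by (rule subgroup_comm_group)
  \<comment> \<open>By the rank condition p^r + 1 elements of P would generate a subgroup with at
    most r generators, but in an abelian group of exponent p such a subgroup has at most p^r
    elements.\<close>
  have fin: "finite P"
  proof (rule ccontr)
    assume "infinite P"
    then obtain F where F: "finite F" "card F = Suc (p ^ r)" "F \<subseteq> P"
      using infinite_arbitrarily_large by blast
    have FG: "F \<subseteq> carrier G" using F Pc by blast
    obtain T where T: "T \<subseteq> carrier G" "finite T" "card T \<le> r" "generate G T = generate G F"
      using rank[OF F(1) FG] by blast
    have "generate G F \<subseteq> P" using F(3) subP by (rule generate_subgroup_incl)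
    moreover have "T \<subseteq> generate G T" using generate.incl[of _ T G] by blast
    ultimately have TP: "T \<subseteq> P" using T(4) by simp
    have K: "generate (G\<lparr>carrier := P\<rparr>) T = generate G F"
      using generate_consistent[OF TP subP] T(4) by simp
    have "x [^]\<^bsub>G\<lparr>carrier := P\<rparr>\<^esub> p = \<one>\<^bsub>G\<lparr>carrier := P\<rparr>\<^esub>" if "x \<in> P" for x
      using exp[OF that] by (simp flip: nat_pow_consistent)
    then have "finite (generate G F)" "card (generate G F) \<le> p ^ card T"
      using K.card_generate_exponent[of T p] T(2) TP p0 K by auto
    moreover have "F \<subseteq> generate G F" using generate.incl[of _ F G] by blast
    ultimately have "card F \<le> p ^ card T" using card_mono le_trans by blast
    also have "\<dots> \<le> p ^ r" using T(3) p0 by (intro power_increasing) auto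
    finally show False using F(2) by simp
  qed
  have conjP: "conjugate z x \<in> P" if "z \<in> carrier G" "x \<in> P" for z x
    unfolding P_def conjugate_def
    by (rule normal.inv_op_closed2[OF derived_self_is_normal]) (use that P_def in auto)
  \<comment> \<open>Pigeonhole: among the conjugates of x by z^0, ..., z^|P| two coincide, so x is
    fixed by some z^(j-i) with 0 < j - i \<le> |P|, and j - i divides the factorial.\<close>
  have fact_pow: "conjugate (z [^] (fact (card P) :: nat)) x = x" if z: "z \<in> carrier G" and x: "x \<in> P" for z x
  proof -
    have "\<not> inj_on (\<lambda>i::nat. conjugate (z [^] i) x) {..card P}"
    proof
      assume "inj_on (\<lambda>i::nat. conjugate (z [^] i) x) {..card P}"
      then have "card {..card P} \<le> card P"
        by (rule card_inj_on_le) (use conjP z x fin in auto)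
      then show False by simp
    qed
    then obtain i j where ij: "i < j" "j \<le> card P" "conjugate (z [^] i) x = conjugate (z [^] j) x"
      unfolding inj_on_def by (metis atMost_iff linorder_neqE_nat)
    have "conjugate (z [^] j) x = conjugate (z [^] i) (conjugate (z [^] (j - i)) x)"
      using ij(1) z Pc[OF x] by (simp add: conjugate_conjugate nat_pow_mult)
    then have fixed: "conjugate (z [^] (j - i)) x = x"
      using conjugate_inj[of "z [^] i" "conjugate (z [^] (j - i)) x" x] ij(3) z Pc[OF x] by simp
    have "j - i dvd fact (card P)" using ij by (intro dvd_fact) auto
    then obtain l where l: "fact (card P) = (j - i) * l" by (elim dvdE)
    have "(conjugate (z [^] (j - i)) ^^ l) x = x" by (induction l) (simp_all add: fixed)
    then show ?thesis
      unfolding l using conjugate_pow[of "z [^] (j - i)" x l] z Pc[OF x] by (simp add: nat_pow_pow)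
  qed
  have central: "conjugate g x = x" if g: "g \<in> carrier G" and x: "x \<in> P" for g x
  proof (cases "g \<in> free")
    case True
    obtain z where z: "z \<in> free" "z [^] (fact (card P) :: nat) = g"
      using free_root[OF True, of "fact (card P)"] by auto
    then show ?thesis using fact_pow[of z x] x by (auto simp: free_def)
  next
    case False
    then have "g \<in> P" using g P carrier_eq by blast
    then show ?thesis using comm[OF _ x] conjugate_eq_iff[OF g Pc[OF x] Pc[OF x]] by simp
  qed
  have free_central: "conjugate x y = y" if x: "x \<in> carrier G" and y: "y \<in> free" for x y
  proof -
    obtain z where z: "z \<in> free" "z [^] p = y" using free_root[OF y] p0 by blast
    have zc: "z \<in> carrier G" using z(1) by (simp add: free_def)
    define c where "c = x \<otimes> z \<otimes> inv x \<otimes> inv z"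
    have c: "c \<in> P" unfolding P_def c_def derived_def using x zc by (intro generate.incl) blast
    have cz: "conjugate x z = c \<otimes> z" using x zc by (simp add: c_def conjugate_def m_assoc)
    have "c \<otimes> z = z \<otimes> c" using central[OF zc c] conjugate_eq_iff[OF zc Pc[OF c] Pc[OF c]] by simp
    then have "(c \<otimes> z) [^] p = c [^] p \<otimes> z [^] p" using Pc[OF c] zc by (rule pow_mult_distrib)
    moreover have "y \<in> carrier G" using y by (simp add: free_def)
    ultimately show ?thesis using conjugate_nat_pow[OF x zc, of p] exp[OF c] z(2) cz zc by simp
  qed
  have "x \<otimes> y = y \<otimes> x" if x: "x \<in> carrier G" and y: "y \<in> carrier G" for x y
  proof -
    have "conjugate x y = y"
    proof (cases "y \<in> free")
      case False
      then have "y \<in> P" using y P carrier_eq by blast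
      then show ?thesis using central x by simp
    qed (use free_central x in simp)
    then show ?thesis using conjugate_eq_iff[OF x y y] by simp
  qed
  then show False using not_commutative by blast
qed

end

text \<open>Used to multiply a square array of conjugates by rows and by columns.\<close>

lemma (in comm_monoid) finprod_swap:
  assumes "finite I" "finite J" "\<And>i j. \<lbrakk>i \<in> I; j \<in> J\<rbrakk> \<Longrightarrow> f i j \<in> carrier G"
  shows "(\<Otimes>i\<in>I. \<Otimes>j\<in>J. f i j) = (\<Otimes>j\<in>J. \<Otimes>i\<in>I. f i j)"
  using assms(1,3)
proof (induction I rule: finite_induct)
  case empty
  then show ?case by simp
next
  case (insert i I)
  have c: "f i \<in> J \<rightarrow> carrier G" "\<And>j. j \<in> J \<Longrightarrow> (\<lambda>i. f i j) \<in> I \<rightarrow> carrier G"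
    using insert.prems by auto
  have "(\<Otimes>i\<in>insert i I. \<Otimes>j\<in>J. f i j) = (\<Otimes>j\<in>J. f i j) \<otimes> (\<Otimes>j\<in>J. \<Otimes>i\<in>I. f i j)"
    using insert by (subst finprod_insert) (auto intro!: finprod_closed)
  also have "\<dots> = (\<Otimes>j\<in>J. f i j \<otimes> (\<Otimes>i\<in>I. f i j))"
    using c by (intro finprod_multf[symmetric]) (auto intro!: finprod_closed)
  also have "\<dots> = (\<Otimes>j\<in>J. \<Otimes>i\<in>insert i I. f i j)"
    using insert c by (intro finprod_cong') (auto intro!: finprod_closed)
  finally show ?case .
qed

section \<open>The action on a torsion-free derived subgroup\<close>

locale derived_free = three_orbits +
  assumes derived_eq: "derived G (carrier G) = insert \<one> free"
begin

definition A :: "'a set" where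
  "A = derived G (carrier G)"

lemma A_eq: "A = insert \<one> free"
  by (simp add: A_def derived_eq)

lemma normal_A: "A \<lhd> G"
  unfolding A_def by (rule derived_self_is_normal)

lemma subgroup_A: "subgroup A G"
  using normal_A by (rule normal_imp_subgroup)

lemma A_carrier: "a \<in> A \<Longrightarrow> a \<in> carrier G"
  by (rule subgroup.mem_carrier[OF subgroup_A])

lemma A_commute: "\<lbrakk>a \<in> A; b \<in> A\<rbrakk> \<Longrightarrow> a \<otimes> b = b \<otimes> a"
  unfolding A_def by (rule derived_cases(2))

lemma conjugate_A: "\<lbrakk>x \<in> carrier G; a \<in> A\<rbrakk> \<Longrightarrow> conjugate x a \<in> A"
  unfolding conjugate_def by (rule normal.inv_op_closed2[OF normal_A])

lemma torsion_iff: "x \<in> torsion \<longleftrightarrow> x \<in> carrier G \<and> x \<notin> A"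
  unfolding A_eq by (auto simp: torsion_def free_def)

lemma torsion_free_A: "\<lbrakk>a \<in> A; a [^] (n::nat) = \<one>; n > 0\<rbrakk> \<Longrightarrow> a = \<one>"
  using pow_eq_id[OF A_carrier, of a n] unfolding A_eq by (auto simp: free_def)

lemma comm_group_A: "comm_group (G\<lparr>carrier := A\<rparr>)"
  using subgroup_A A_commute by (rule subgroup_comm_group)

text \<open>The commutator of u and v lies in the abelian group A and so acts trivially on it. Hence
  the actions on A commute even where u and v do not.\<close>

lemma conjugate_swap:
  assumes u: "u \<in> carrier G" and v: "v \<in> carrier G" and a: "a \<in> A"
  shows "conjugate u (conjugate v a) = conjugate v (conjugate u a)"
proof -
  define c where "c = u \<otimes> v \<otimes> inv u \<otimes> inv v"
  have c: "c \<in> A" unfolding A_def c_def derived_def using u v by (intro generate.incl) blast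
  have "inv v \<otimes> (v \<otimes> u) = u" using u v by (simp flip: m_assoc)
  then have "c \<otimes> (v \<otimes> u) = u \<otimes> v"
    unfolding c_def using u v by (simp add: m_assoc)
  then have "conjugate u (conjugate v a) = conjugate c (conjugate (v \<otimes> u) a)"
    using u v A_carrier[OF a] A_carrier[OF c] by (simp add: conjugate_conjugate)
  also have "\<dots> = conjugate (v \<otimes> u) a"
  proof -
    have w: "conjugate (v \<otimes> u) a \<in> A" using u v a by (simp add: conjugate_A)
    show ?thesis
      using A_commute[OF c w] conjugate_eq_iff[OF A_carrier[OF c] A_carrier[OF w] A_carrier[OF w]] by simp
  qed
  finally show ?thesis using u v A_carrier[OF a] by (simp add: conjugate_conjugate)
qed

lemma conjugate_mult_pow:
  assumes u: "u \<in> carrier G" and v: "v \<in> carrier G" and a: "a \<in> A"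
  shows "conjugate ((u \<otimes> v) [^] i) a = conjugate (u [^] i) (conjugate (v [^] (i::nat)) a)"
proof (induction i)
  case 0
  then show ?case using A_carrier[OF a] by simp
next
  case (Suc i)
  have va: "conjugate (v [^] i) a \<in> A" using v a by (simp add: conjugate_A)
  have "conjugate ((u \<otimes> v) [^] Suc i) a = conjugate (u \<otimes> v) (conjugate ((u \<otimes> v) [^] i) a)"
    using nat_pow_Suc2[of "u \<otimes> v" i] u v A_carrier[OF a] by (simp add: conjugate_conjugate)
  also have "\<dots> = conjugate u (conjugate v (conjugate (u [^] i) (conjugate (v [^] i) a)))"
    unfolding Suc using u v A_carrier[OF va] by (simp add: conjugate_conjugate m_assoc)
  also have "\<dots> = conjugate u (conjugate (u [^] i) (conjugate v (conjugate (v [^] i) a)))"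
    using conjugate_swap[OF v _ va, of "u [^] i"] u by simp
  also have "\<dots> = conjugate (u [^] Suc i) (conjugate (v [^] Suc i) a)"
    using nat_pow_Suc2[of u i] nat_pow_Suc2[of v i] u v A_carrier[OF a]
    by (simp add: conjugate_conjugate m_assoc)
  finally show ?case .
qed

context
  fixes p :: nat
  assumes p: "Factorial_Ring.prime p" and ord_torsion: "\<And>x. x \<in> torsion \<Longrightarrow> ord x = p"
begin

lemma torsion_pow: "x \<in> torsion \<Longrightarrow> x [^] p = \<one>"
  using pow_ord_eq_1[of x] ord_torsion[of x] by (auto simp: torsion_def)

text \<open>The product x a lies outside A, so it has order p. If x and a commute, then 1 = (x a)^p
  = a^p, and A is torsion-free.\<close>

lemma torsion_fpf:
  assumes x: "x \<in> torsion" and a: "a \<in> A" and fixed: "conjugate x a = a"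
  shows "a = \<one>"
proof (rule ccontr)
  assume "a \<noteq> \<one>"
  have xc: "x \<in> carrier G" "x \<notin> A" using x torsion_iff by auto
  have ac: "a \<in> carrier G" using a by (rule A_carrier)
  have "x \<otimes> a \<notin> A"
  proof
    assume "x \<otimes> a \<in> A"
    then have "x \<otimes> a \<otimes> inv a \<in> A"
      by (rule subgroup.m_closed[OF subgroup_A _ subgroup.m_inv_closed[OF subgroup_A a]])
    then show False using xc ac by (simp add: m_assoc)
  qed
  then have "x \<otimes> a \<in> torsion" using xc ac torsion_iff by simp
  then have "(x \<otimes> a) [^] p = \<one>" by (rule torsion_pow)
  moreover have "x \<otimes> a = a \<otimes> x" using fixed conjugate_eq_iff[OF xc(1) ac ac] by simp
  ultimately have "a [^] p = \<one>" using pow_mult_distrib[of x a p] xc ac torsion_pow[OF x] by simp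
  then show False using torsion_free_A[OF a _ prime_gt_0_nat[OF p]] \<open>a \<noteq> \<one>\<close> by simp
qed

lemma mem_subgroup_if_pow_mem:
  assumes N: "subgroup N G" and y: "y \<in> carrier G" "y [^] p = \<one>" and k: "\<not> p dvd k" "y [^] (k::nat) \<in> N"
  shows "y \<in> N"
proof -
  have "coprime p k" using p k(1) by (rule prime_imp_coprime)
  then have "coprime (int p) (int k)" by simp
  then have "gcd (int p) (int k) = 1" by (rule coprime_imp_gcd_eq_1)
  moreover obtain v u where "v * int p + u * int k = gcd (int p) (int k)"
    using bezout_int[of "int p" "int k"] by blast
  ultimately have uv: "int k * u + int p * v = 1" by (simp add: mult.commute add.commute)
  have "y = y [^] (int k * u + int p * v)" unfolding uv using y(1) by simp
  also have "\<dots> = (y [^] int k) [^] u \<otimes> (y [^] int p) [^] v"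
    using y(1) by (simp add: int_pow_mult int_pow_pow)
  also have "\<dots> = (y [^] k) [^] u" using y by (simp add: int_pow_int)
  finally show ?thesis using subgroup_int_pow_closed[OF N k(2), of u] by simp
qed

lemma pow_torsion:
  assumes "x \<in> torsion" "\<not> p dvd k"
  shows "x [^] (k::nat) \<in> torsion"
proof -
  have x: "x \<in> carrier G" "x \<notin> A" using assms(1) torsion_iff by simp_all
  have "x [^] k \<notin> A"
    using mem_subgroup_if_pow_mem[OF subgroup_A x(1) torsion_pow[OF assms(1)] assms(2)] x(2) by blast
  then show ?thesis using x(1) torsion_iff by simp
qed

lemma conjugate_finprod:
  assumes "finite I" "f \<in> I \<rightarrow> A" "x \<in> carrier G"
  shows "conjugate x (finprod (G\<lparr>carrier := A\<rparr>) f I) = finprod (G\<lparr>carrier := A\<rparr>) (\<lambda>i. conjugate x (f i)) I"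
  using assms(1,2)
proof (induction I rule: finite_induct)
  case empty
  interpret K: comm_group "G\<lparr>carrier := A\<rparr>" by (rule comm_group_A)
  show ?case using K.finprod_empty assms(3) by simp
next
  case (insert i I)
  interpret K: comm_group "G\<lparr>carrier := A\<rparr>" by (rule comm_group_A)
  let ?K = "G\<lparr>carrier := A\<rparr>"
  have f: "f i \<in> A" "f \<in> I \<rightarrow> A" using insert.prems by auto
  have F: "finprod ?K f I \<in> A" using K.finprod_closed[of f I] f by simp
  have cf: "(\<lambda>i. conjugate x (f i)) \<in> I \<rightarrow> carrier ?K" "conjugate x (f i) \<in> carrier ?K"
    using f assms(3) conjugate_A by auto
  have "finprod ?K f (insert i I) = f i \<otimes> finprod ?K f I"
    using K.finprod_insert[OF insert.hyps, of f] f by simp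
  then have "conjugate x (finprod ?K f (insert i I)) = conjugate x (f i) \<otimes> conjugate x (finprod ?K f I)"
    using f(1) F assms(3) by (simp add: conjugate_mult A_carrier)
  also have "\<dots> = conjugate x (f i) \<otimes> finprod ?K (\<lambda>i. conjugate x (f i)) I"
    using insert.IH f(2) by simp
  also have "\<dots> = finprod ?K (\<lambda>i. conjugate x (f i)) (insert i I)"
    using K.finprod_insert[OF insert.hyps cf] by simp
  finally show ?case .
qed

text \<open>Conjugation by z permutes the factors cyclically, so the product is a fixed
  point.\<close>

lemma norm_eq_one:
  assumes z: "z \<in> torsion" and a: "a \<in> A"
  shows "finprod (G\<lparr>carrier := A\<rparr>) (\<lambda>i. conjugate (z [^] i) a) {..<p} = \<one>"
proof -
  let ?K = "G\<lparr>carrier := A\<rparr>"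
  interpret K: comm_group ?K by (rule comm_group_A)
  obtain m where m: "p = Suc m" using p by (cases p) auto
  have zc: "z \<in> carrier G" using z torsion_iff by simp
  define f where "f i = conjugate (z [^] i) a" for i :: nat
  have f: "f i \<in> A" for i unfolding f_def using zc a by (simp add: conjugate_A)
  have fin: "finprod ?K f {..m} \<in> A" "finprod ?K (\<lambda>i. f (Suc i)) {..m} \<in> A"
    using K.finprod_closed[of f "{..m}"] K.finprod_closed[of "\<lambda>i. f (Suc i)" "{..m}"] f by auto
  \<comment> \<open>In the product over 0, ..., p the first and the last factor equal a, because z^p
    = 1. Splitting off either one shows that shifting the index leaves the norm unchanged.\<close>
  have ends: "f (Suc m) = a" "f 0 = a" unfolding f_def using torsion_pow[OF z] A_carrier[OF a] by (simp_all only: m nat_pow_0 conjugate_one)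
  have "a \<otimes> finprod ?K f {..m} = finprod ?K f {..Suc m}"
    using K.finprod_Suc[of f m] f ends(1) by simp
  also have "\<dots> = finprod ?K (\<lambda>i. f (Suc i)) {..m} \<otimes> a"
    using K.finprod_Suc2[of f m] f ends(2) by simp
  also have "\<dots> = a \<otimes> finprod ?K (\<lambda>i. f (Suc i)) {..m}"
    by (rule A_commute[OF fin(2) a])
  finally have shift: "finprod ?K f {..m} = finprod ?K (\<lambda>i. f (Suc i)) {..m}"
    using A_carrier fin a by simp
  have "conjugate z (finprod ?K f {..m}) = finprod ?K (\<lambda>i. conjugate z (f i)) {..m}"
    using f zc by (intro conjugate_finprod) auto
  also have "\<dots> = finprod ?K (\<lambda>i. f (Suc i)) {..m}"
  proof (rule K.finprod_cong')
    show "conjugate z (f i) = f (Suc i)" for i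
      unfolding f_def using nat_pow_Suc2[OF zc, of i] zc A_carrier[OF a] by (simp add: conjugate_conjugate)
  qed (use f in auto)
  finally have "conjugate z (finprod ?K f {..m}) = finprod ?K f {..m}" using shift by simp
  then have "finprod ?K f {..m} = \<one>" by (rule torsion_fpf[OF z fin(1)])
  then show ?thesis unfolding m lessThan_Suc_atMost f_def .
qed

text \<open>Otherwise \<open>x\<close> and \<open>y\<close> generate a subgroup of order \<open>p\<^sup>2\<close> of \<open>G / A\<close>. Multiplying the norms of
  \<open>a\<close> along the \<open>p\<close> lines spanned by \<open>x y\<^sup>k\<close> gives \<open>a\<^sup>p\<close> times norms along \<open>y\<close>, and all norms are
  trivial because they are fixed points.\<close>

lemma mem_A_mult_powers:
  assumes x: "x \<in> torsion" and N: "subgroup N G" "A \<subseteq> N" "x \<in> N" and y: "y \<in> carrier G"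
  shows "y \<in> N"
proof (rule ccontr)
  assume yN: "y \<notin> N"
  let ?K = "G\<lparr>carrier := A\<rparr>"
  interpret K: comm_group ?K by (rule comm_group_A)
  have p0: "p > 0" using p by (rule prime_gt_0_nat)
  have xc: "x \<in> carrier G" "x \<notin> A" using x torsion_iff by simp_all
  have yt: "y \<in> torsion" using yN N(2) y torsion_iff by blast
  \<comment> \<open>Were x y^k in A, then y^k would lie in N. If p does not divide k, this puts y
    into N; if it does, y^k = 1 and x itself would be in A.\<close>
  have xy: "x \<otimes> y [^] k \<in> torsion" for k :: nat
  proof -
    have "x \<otimes> y [^] k \<notin> A"
    proof
      assume xyA: "x \<otimes> y [^] k \<in> A"
      then have "inv x \<otimes> (x \<otimes> y [^] k) \<in> N"
        using N subgroup.m_closed[OF N(1)] subgroup.m_inv_closed[OF N(1)] by blast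
      then have yk: "y [^] k \<in> N" using xc y by (simp flip: m_assoc)
      show False
      proof (cases "p dvd k")
        case True
        then obtain l where "k = p * l" by (elim dvdE)
        then have "y [^] k = \<one>" using nat_pow_pow[OF y, of p l] torsion_pow[OF yt] by simp
        then show False using xyA xc by simp
      next
        case False
        then show False using mem_subgroup_if_pow_mem[OF N(1) y torsion_pow[OF yt] False yk] yN by simp
      qed
    qed
    then show ?thesis using xc y torsion_iff by simp
  qed
  obtain a where a: "a \<in> A" "a \<noteq> \<one>" using ex_free free_ne_one unfolding A_eq free_def by blast
  have ac: "a \<in> carrier G" using A_carrier[OF a(1)] .
  let ?f = "\<lambda>(k::nat) (i::nat). conjugate (x [^] i) (conjugate ((y [^] i) [^] k) a)"
  have f: "?f k i \<in> A" for k i using xc y a by (simp add: conjugate_A)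
  \<comment> \<open>For fixed k the factors are the conjugates of a by powers of x y^k, since the
    actions of x and y on A commute.\<close>
  have rows: "finprod ?K (?f k) {..<p} = \<one>" for k
  proof -
    have "?f k i = conjugate ((x \<otimes> y [^] k) [^] i) a" for i
      using conjugate_mult_pow[OF xc(1) _ a(1), of "y [^] k" i] y by (simp add: nat_pow_pow mult.commute)
    then show ?thesis using norm_eq_one[OF xy[of k] a(1)] by simp
  qed
  \<comment> \<open>For fixed i > 0 the product is the image under x^i of a norm along y^i, which is
    again a torsion element; for i = 0 all p factors are a.\<close>
  have cols: "finprod ?K (\<lambda>k. ?f k i) {..<p} = (if 0 = i then a [^] p else \<one>)" if i: "i < p" for i
  proof -
    have "finprod ?K (\<lambda>k. ?f k i) {..<p}
      = conjugate (x [^] i) (finprod ?K (\<lambda>k. conjugate ((y [^] i) [^] k) a) {..<p})"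
      using xc y a(1) by (intro conjugate_finprod[symmetric]) (auto intro!: conjugate_A)
    also have "\<dots> = (if 0 = i then a [^] p else \<one>)"
    proof (cases "i = 0")
      case True
      have "finprod ?K (\<lambda>k. a) {..<p} = a [^]\<^bsub>?K\<^esub> p"
        using K.finprod_const[of a "{..<p}"] a(1) by simp
      then show ?thesis using True ac by (simp flip: nat_pow_consistent)
    next
      case False
      then have "\<not> p dvd i" using i by (auto dest: dvd_imp_le)
      then have "finprod ?K (\<lambda>k. conjugate ((y [^] i) [^] k) a) {..<p} = \<one>"
        using norm_eq_one[OF pow_torsion[OF yt] a(1)] by simp
      then show ?thesis using False xc by simp
    qed
    finally show ?thesis .
  qed
  have ap: "a [^] p \<in> A" by (rule subgroup_nat_pow_closed[OF subgroup_A a(1)])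
  have "\<one> = finprod ?K (\<lambda>k. finprod ?K (?f k) {..<p}) {..<p}"
    unfolding rows using K.finprod_one[of "{..<p}"] by simp
  also have "\<dots> = finprod ?K (\<lambda>i. finprod ?K (\<lambda>k. ?f k i) {..<p}) {..<p}"
    using f by (intro K.finprod_swap) auto
  also have "\<dots> = finprod ?K (\<lambda>i. if 0 = i then a [^] p else \<one>) {..<p}"
    by (rule K.finprod_cong') (use cols ap subgroup.one_closed[OF subgroup_A] in auto)
  also have "\<dots> = a [^] p"
    using K.finprod_singleton[of 0 "{..<p}" "\<lambda>_. a [^] p"] p0 ap by (simp cong: if_cong)
  finally have "a = \<one>" using torsion_free_A[OF a(1) _ p0] by simp
  then show False using a(2) by simp
qed

text \<open>Any torsion element x generates a complement: its powers meet the torsion-free A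
  trivially, and the product with A contains both A and x.\<close>

lemma semidirect_decomposition:
  obtains H where "internal_semidirect G A H" "card H = p" "fixed_point_free_conj G H A"
proof -
  obtain x where x: "x \<in> torsion" using ex_torsion by (auto simp: torsion_def)
  have xc: "x \<in> carrier G" "x \<notin> A" using x torsion_iff by simp_all
  define H where "H = generate G {x}"
  have subH: "subgroup H G" unfolding H_def by (rule generate_is_subgroup) (use xc in simp)
  have xH: "x \<in> H" unfolding H_def by (rule generate.incl) simp
  have cardH: "card H = p" unfolding H_def using generate_pow_card[OF xc(1)] ord_torsion[OF x] by simp
  have Hpow: "h [^] p = \<one>" if "h \<in> H" for h
  proof (cases "h = \<one>")
    case False
    have "h \<in> carrier G" using subgroup.mem_carrier[OF subH that] .
    then show ?thesis using pow_ord_eq_1[of h] prime_card_subgroup(1)[OF subH cardH p that False] by simp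
  qed simp
  have p0: "p > 0" using p by (rule prime_gt_0_nat)
  have one: "\<one> \<in> A" "\<one> \<in> H" using subgroup.one_closed subgroup_A subH by blast+
  have int: "h = \<one>" if "h \<in> A" "h \<in> H" for h
    using torsion_free_A[OF that(1) Hpow[OF that(2)] p0] .
  have "A <#> H = carrier G"
  proof
    have N: "subgroup (A <#> H) G" by (rule mult_norm_subgroup[OF normal_A subH])
    show "A <#> H \<subseteq> carrier G" using subgroup.subset[OF N] .
    have "a \<in> A <#> H" if "a \<in> A" for a
      using one(2) that A_carrier[OF that] unfolding set_mult_def by force
    moreover have "x \<in> A <#> H" using xH one(1) xc unfolding set_mult_def by force
    ultimately show "carrier G \<subseteq> A <#> H" using mem_A_mult_powers[OF x N] by blast
  qed
  then have "internal_semidirect G A H"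
    unfolding internal_semidirect_def using normal_A subH one int by blast
  moreover have "fixed_point_free_conj G H A"
    unfolding fixed_point_free_conj_def
  proof (intro ballI notI)
    fix h a assume h: "h \<in> H - {\<one>}" and a: "a \<in> A - {\<one>}" and eq: "h \<otimes> a \<otimes> inv h = a"
    have "h \<notin> A" using int h by blast
    then have "h \<in> torsion" using h subgroup.mem_carrier[OF subH] torsion_iff by simp
    then show False using torsion_fpf[of h a] eq a by (simp add: conjugate_def)
  qed
  ultimately show thesis using cardH that by blast
qed

end

lemma iso_rational_power:
  assumes rank: "\<And>S. \<lbrakk>finite S; S \<subseteq> carrier G\<rbrakk> \<Longrightarrow>
      \<exists>T\<subseteq>carrier G. finite T \<and> card T \<le> r \<and> generate G T = generate G S"
  obtains n where "n > 0" "G\<lparr>carrier := A\<rparr> \<cong> rational_power_group n"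
proof -
  let ?K = "G\<lparr>carrier := A\<rparr>"
  interpret K: comm_group ?K by (rule comm_group_A)
  have int_pow: "x [^]\<^bsub>?K\<^esub> k = x [^] k" if "x \<in> A" for x and k :: int
    using int_pow_consistent[OF subgroup_A that] by simp
  show thesis
  proof (rule K.torsion_free_divisible_iso[of r])
    show "x = \<one>\<^bsub>?K\<^esub>" if "x \<in> carrier ?K" "k \<noteq> 0" "x [^]\<^bsub>?K\<^esub> k = \<one>\<^bsub>?K\<^esub>" for x and k :: int
    proof -
      have x: "x \<in> A" "x [^] k = \<one>" using that int_pow by auto
      then have "int (ord x) dvd k" using int_pow_eq_id[OF A_carrier] by blast
      then have "ord x \<noteq> 0" using that(2) by (intro notI) simp
      then show ?thesis using x(1) unfolding A_eq by (simp add: free_def)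
    qed
    show "\<exists>y\<in>carrier ?K. y [^]\<^bsub>?K\<^esub> k = x" if "x \<in> carrier ?K" "k \<noteq> 0" for x and k :: int
    proof -
      have x: "x \<in> A" and k: "nat \<bar>k\<bar> > 0" using that by simp_all
      have "\<exists>y\<in>A. y [^] (nat \<bar>k\<bar>) = x"
      proof (cases "x = \<one>")
        case True
        then show ?thesis using x by (intro bexI[of _ x]) simp_all
      next
        case False
        then have "x \<in> free" using x A_eq by simp
        then obtain z where "z \<in> free" "z [^] (nat \<bar>k\<bar>) = x" by (rule free_root[OF _ k])
        then show ?thesis using A_eq by blast
      qed
      then obtain y where y: "y \<in> A" "y [^] (nat \<bar>k\<bar>) = x" by blast
      have yc: "y \<in> carrier G" using A_carrier[OF y(1)] .
      show ?thesis
      proof (cases "k \<ge> 0")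
        case True
        then have "y [^] k = x" using y(2) int_pow_int[of G y "nat k"] by simp
        then show ?thesis using y(1) int_pow[OF y(1)] by (intro bexI[of _ y]) simp_all
      next
        case False
        \<comment> \<open>For negative k the inverse of a |k|-th root is a k-th root.\<close>
        have iy: "inv y \<in> A" by (rule subgroup.m_inv_closed[OF subgroup_A y(1)])
        have "inv y [^] k = y [^] (- k)" using yc by (simp add: int_pow_inv int_pow_neg)
        also have "\<dots> = x" using False y(2) int_pow_int[of G y "nat (- k)"] by simp
        finally show ?thesis using iy int_pow[OF iy] by (intro bexI[of _ "inv y"]) simp_all
      qed
    qed
    show "\<exists>T\<subseteq>carrier ?K. finite T \<and> card T \<le> r \<and> generate ?K T = generate ?K S"
      if S: "finite S" "S \<subseteq> carrier ?K" for S
    proof -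
      have SA: "S \<subseteq> A" using S(2) by simp
      then have "S \<subseteq> carrier G" using A_carrier by blast
      then obtain T where T: "T \<subseteq> carrier G" "finite T" "card T \<le> r" "generate G T = generate G S"
        using rank[OF S(1)] by blast
      \<comment> \<open>The generators supplied inside G lie in the subgroup they generate, hence in
        A, so they also bound the rank of A.\<close>
      have "generate G S \<subseteq> A" using SA subgroup_A by (rule generate_subgroup_incl)
      moreover have "T \<subseteq> generate G T" using generate.incl[of _ T G] by blast
      ultimately have TA: "T \<subseteq> A" using T(4) by simp
      have "generate ?K T = generate ?K S"
        unfolding generate_consistent[OF TA subgroup_A] generate_consistent[OF SA subgroup_A] by (rule T(4))
      then show ?thesis using T(2,3) TA by (intro exI[of _ T]) simp
    qed
    show "carrier ?K \<noteq> {\<one>\<^bsub>?K\<^esub>}"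
      using ex_free free_ne_one A_eq by (auto simp: free_def)
  qed (rule that)
qed

end

lemma (in group) semidirect_if_num_aut_orbits_eq_3:
  assumes solv: "solvable G" and mixed: "mixed_order G" and rk: "finite_rank G" and orb: "num_aut_orbits G = 3"
  obtains A H p n where "internal_semidirect G A H" "Factorial_Ring.prime p" "card H = p"
    "fixed_point_free_conj G H A" "n > 0" "G\<lparr>carrier := A\<rparr> \<cong> rational_power_group n"
proof -
  obtain x y where x: "x \<in> carrier G" "x \<noteq> \<one>" "ord x \<noteq> 0" and y: "y \<in> carrier G" "ord y = 0"
    using mixed unfolding mixed_order_def by blast
  have from_x: "\<And>z. \<lbrakk>z \<in> carrier G; z \<noteq> \<one>; ord z \<noteq> 0\<rbrakk> \<Longrightarrow> \<exists>f\<in>auto G. f x = z"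
    and from_y: "\<And>z. \<lbrakk>z \<in> carrier G; ord z = 0\<rbrakk> \<Longrightarrow> \<exists>f\<in>auto G. f y = z"
    using num_aut_orbits_eq_3[OF x y] orb by simp_all
  \<comment> \<open>The three-orbit criterion only moves the representatives x and y; since c and f
    c have the same orbit, this carries over to arbitrary starting points.\<close>
  have trans: "\<exists>f\<in>auto G. f u = w"
    if "c \<in> carrier G" and u: "\<exists>f\<in>auto G. f c = u" and w: "\<exists>f\<in>auto G. f c = w" for c u w
  proof -
    obtain f where f: "f \<in> auto G" "f c = u" using u by (elim bexE)
    have "w \<in> aut_orbit (f c)" using w aut_orbit_eq[OF that(1) f(1)] by (simp add: aut_orbit_mem_iff)
    then show ?thesis unfolding aut_orbit_mem_iff f(2) .
  qed
  interpret three_orbits G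
  proof unfold_locales
    show "solvable G" by (rule solv)
    show "\<exists>x\<in>carrier G. x \<noteq> \<one> \<and> ord x \<noteq> 0" using x by (intro bexI[of _ x] conjI)
    show "\<exists>y\<in>carrier G. ord y = 0" using y by (intro bexI[of _ y])
    show "\<exists>f\<in>auto G. f u = w"
      if "u \<in> carrier G" "u \<noteq> \<one>" "ord u \<noteq> 0" "w \<in> carrier G" "w \<noteq> \<one>" "ord w \<noteq> 0" for u w
      by (rule trans[OF x(1) from_x from_x]) fact+
    show "\<exists>f\<in>auto G. f u = w" if "u \<in> carrier G" "ord u = 0" "w \<in> carrier G" "ord w = 0" for u w
      by (rule trans[OF y(1) from_y from_y]) fact+
  qed
  obtain r where r: "has_rank G r" using rk unfolding finite_rank_def by blast
  have rank: "\<exists>T\<subseteq>carrier G. finite T \<and> card T \<le> r \<and> generate G T = generate G S"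
    if "finite S" "S \<subseteq> carrier G" for S
  proof -
    have "fg_subgroup G (generate G S)" unfolding fg_subgroup_def using that by blast
    then have "gen_by_at_most G (generate G S) r" using r unfolding has_rank_def by blast
    then show ?thesis unfolding gen_by_at_most_def by blast
  qed
  interpret derived_free G
    by unfold_locales (use derived_cases(1) derived_ne_torsion[of r] rank in metis)
  obtain p where p: "Factorial_Ring.prime p" "\<And>x. x \<in> torsion \<Longrightarrow> ord x = p"
    using torsion_prime_order by blast
  obtain H where H: "internal_semidirect G A H" "card H = p" "fixed_point_free_conj G H A"
    using semidirect_decomposition[OF p] by blast
  obtain n where "n > 0" "G\<lparr>carrier := A\<rparr> \<cong> rational_power_group n"
    using iso_rational_power[of r] rank by metis
  then show thesis by (rule that[OF H(1) p(1) H(2,3)])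
qed

theorem theoremB:
  fixes G :: "('a, 'b) monoid_scheme"
  assumes "group G"
    and "solvable G"
    and "mixed_order G"
    and "finite_rank G"
  shows "num_aut_orbits G = 3 \<longleftrightarrow>
    (\<exists>A H. internal_semidirect G A H \<and>
           (\<exists>p::nat. Factorial_Ring.prime p \<and> card H = p) \<and>
           fixed_point_free_conj G H A \<and>
           (\<exists>n>0. G\<lparr>carrier := A\<rparr> \<cong> rational_power_group n))"
proof
  assume "num_aut_orbits G = 3"
  then obtain A H p n where "internal_semidirect G A H" "Factorial_Ring.prime p" "card H = p"
    "fixed_point_free_conj G H A" "n > 0" "G\<lparr>carrier := A\<rparr> \<cong> rational_power_group n"
    using group.semidirect_if_num_aut_orbits_eq_3[OF assms] by metis
  then show "\<exists>A H. internal_semidirect G A H \<and>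
      (\<exists>p::nat. Factorial_Ring.prime p \<and> card H = p) \<and> fixed_point_free_conj G H A \<and>
      (\<exists>n>0. G\<lparr>carrier := A\<rparr> \<cong> rational_power_group n)"
    by blast
next
  assume "\<exists>A H. internal_semidirect G A H \<and>
      (\<exists>p::nat. Factorial_Ring.prime p \<and> card H = p) \<and> fixed_point_free_conj G H A \<and>
      (\<exists>n>0. G\<lparr>carrier := A\<rparr> \<cong> rational_power_group n)"
  then show "num_aut_orbits G = 3"
    by (elim exE conjE) (rule group.num_aut_orbits_semidirect[OF assms(1)])
qed

end
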